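(* Let $m,n,N\ge 1$, let $C^t$ be a positive real-valued conductance function on $T_{m,n}$ that is $N$-periodic under the cluster modular transformation $T$, and let $C$ be the associated $Y$-$\Delta$ consistent conductance function on $\mathbb{Z}^3$. Then the edge probability generating functions $G_p^{[\mu]},G_q^{[\mu]},G_r^{[\mu]}$, $[\mu]\in\mathcal{M}$, satisfy the linear systems $$A\left(G^{[\mu]}_p\right)_{[\mu]\in\mathcal{M}}=\frac{x}{1-x}\left(V^{[\mu]}(0,0,0)+W^{[\mu]}(0,0,0)\right)_{[\mu]\in\mathcal{M}},$$ $$A\left(G^{[\mu]}_q\right)_{[\mu]\in\mathcal{M}}=\frac{y}{1-y}\left(U^{[\mu]}(0,0,0)+W^{[\mu]}(0,0,0)\right)_{[\mu]\in\mathcal{M}},$$ $$A\left(G^{[\mu]}_r\right)_{[\mu]\in\mathcal{M}}=\frac{z}{1-z}\left(U^{[\mu]}(0,0,0)+V^{[\mu]}(0,0,0)\right)_{[\mu]\in\mathcal{M}}.$$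
   Context: $\mathbb{Z}_{\le 0}$ denotes the nonpositive integers. **Initial conditions.** Let $\mathcal{L}\subseteq\mathbb{Z}_{\le 0}^3$ have finite complement in $\mathbb{Z}_{\le 0}^3$ and be down-closed: $(i,j,k)\in\mathcal{L}$ and $i'\le i$, $j'\le j$, $k'\le k$ imply $(i',j',k')\in\mathcal{L}$. The associated set of initial conditions is $\mathcal{I}=\{(i,j,k)\in\mathcal{L}:(i+1,j+1,k+1)\notin\mathcal{L}\}$. **Rhombi.** $r_a(i,j,k)=\{(i,j,k),(i,j-1,k),(i,j,k-1),(i,j-1,k-1)\}$, $r_b(i,j,k)=\{(i,j,k),(i-1,j,k),(i,j,k-1),(i-1,j,k-1)\}$, $r_c(i,j,k)=\{(i,j,k),(i-1,j,k),(i,j-1,k),(i-1,j-1,k)\}$. Long diagonals: $E_a(i,j,k)=\{(i,j-1,k),(i,j,k-1)\}$, $E_b(i,j,k)=\{(i-1,j,k),(i,j,k-1)\}$, $E_c(i,j,k)=\{(i-1,j,k),(i,j-1,k)\}$. Short diagonals: $e_a(i,j,k)=\{(i,j,k),(i,j-1,k-1)\}$, $e_b(i,j,k)=\{(i,j,k),(i-1,j,k-1)\}$, $e_c(i,j,k)=\{(i,j,k),(i-1,j-1,k)\}$. A rhombus is in $\mathcal{I}$ if it is a subset of $\mathcal{I}$. **Groves.** Let $\Gamma_{\mathcal{I}}$ be the graph with vertex set $\mathcal{I}$ whose edges are the long and short diagonals of all rhombi in $\mathcal{I}$. An $\mathcal{I}$-grove is a subgraph $G$ of $\Gamma_{\mathcal{I}}$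 such that: (i) its vertex set is $\mathcal{I}$; (ii) for each rhombus in $\mathcal{I}$ exactly one of its two diagonals is in $G$; (iii) there is $M$ such that whenever all vertices of a rhombus in $\mathcal{I}$ satisfy $i+j+k<-M$, its short diagonal is in $G$; (iv) for $M$ large enough, every component of $G$ contains exactly one of the following sets of vertices, and each such set is contained in some component of $G$: $\{(0,p,q),(p,0,q)\}$, $\{(p,q,0),(0,q,p)\}$, $\{(q,0,p),(q,p,0)\}$ for $0>p>q$ with $p+q\in\{-M-1,-M-2\}$; $\{(0,p,p),(p,0,p),(p,p,0)\}$ for $2p\in\{-M-1,-M-2\}$; $\{(0,0,q)\}$, $\{(0,q,0)\}$, $\{(q,0,0)\}$ for $q\le -M-1$. The set of $\mathcal{I}$-groves is $\mathcal{G}(\mathcal{I})$. **Conductances and edge probabilities.** A conductance function assigns $C_q(i,j,k)$ to $E_q(i,j,k)$ and $c_q(i,j,k)=1/C_q(i,j,k)$ to $e_q(i,j,k)$, $q\in\{a,b,c\}$. It is $Y$-$\Delta$ consistent if for all $(i,j,k)$ the quantities $C_a(i,j,k)c_a(i-1,j,k)$, $C_b(i,j,k)c_b(i,j-1,k)$, $C_c(i,j,k)c_c(i,j,k-1)$ all equal $C_a(i,j,k)C_b(i,j,k)+C_a(i,j,k)C_c(i,j,k)+C_b(i,j,k)C_c(i,j,k)$. For positive $C$ on $\mathbb{Z}^3_{\le 0}$, $\mathbb{P}^C_{\mathcal{I}}$ is the probability measure on $\mathcal{G}(\mathcal{I})$ with $\mathbb{P}^C_{\mathcal{I}}(G)$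 proportional to $\prod_{E_q(i,j,k)\in G}C_q(i,j,k)$. The long edge probabilities are $p(i,j,k)=\mathbb{P}^C_{\mathcal{I}}(E_a(i,j,k)\in G)$, $q(i,j,k)=\mathbb{P}^C_{\mathcal{I}}(E_b(i,j,k)\in G)$, $r(i,j,k)=\mathbb{P}^C_{\mathcal{I}}(E_c(i,j,k)\in G)$, where $\mathcal{I}$ is any set of initial conditions containing $r_a(i,j,k)$, respectively $r_b(i,j,k)$, $r_c(i,j,k)$ (for $Y$-$\Delta$ consistent $C$ the value does not depend on $\mathcal{I}$). Put $\Delta(i,j,k)=C_b(i,j-1,k)C_c(i,j,k-1)+C_a(i-1,j,k)C_c(i,j,k-1)+C_a(i-1,j,k)C_b(i,j-1,k)$ and $U(i,j,k)=\frac{C_b(i,j-1,k)C_c(i,j,k-1)}{\Delta(i,j,k)}$, $V(i,j,k)=\frac{C_a(i-1,j,k)C_c(i,j,k-1)}{\Delta(i,j,k)}$, $W(i,j,k)=\frac{C_a(i-1,j,k)C_b(i,j-1,k)}{\Delta(i,j,k)}$. **Shifts.** For $C$ defined on $\mathbb{Z}^3$ and $\mu\in\mathbb{Z}^3$, let $C^\mu_q(i,j,k)=C_q((i,j,k)+\mu)$ and let $p^\mu,q^\mu,r^\mu,U^\mu,V^\mu,W^\mu$ be the quantities above for $C^\mu$ (restricted to $(i,j,k)\in\mathbb{Z}^3_{\le 0}$). Define the formal power series $G_p^\mu(x,y,z)=\sum_{i,j,k\ge 0}p^\mu(-i,-j,-k)x^iy^jz^k$, and similarly $G_q^\mu$,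 $G_r^\mu$ from $q^\mu$, $r^\mu$. **Conductances on $T_{m,n}$ and periodicity.** The triangular lattice in the plane $i+j+k=-1$ has as edges the long diagonals $E_q(i,j,k)$ with $i+j+k=0$. $T_{m,n}$ is its quotient by the translations $(-m,m,0)$ and $(0,n,-n)$, so a conductance function $C^t$ on $T_{m,n}$, considered modulo global scaling, is given by values $C_q(i,j,k)$, $q\in\{a,b,c\}$, $i+j+k=0$, invariant under these two translations. Fixing the scale, extend these values by the $Y$-$\Delta$ equations to the unique positive $Y$-$\Delta$ consistent conductance function $C$ on all of $\mathbb{Z}^3$ (the $Y$-$\Delta$ equations required for all $(i,j,k)\in\mathbb{Z}^3$); this is the associated $C$. The cluster modular transformation $T$ performs a $Y$-$\Delta$ move on every downward triangle, translates, and takes the dual graph; explicitly $(TC^t)_q(i,j,k)=C_q(i-1,j,k)$ for $i+j+k=0$, and similarly $(T^NC^t)_q(i,j,k)=C_q(i-N,j,k)$. $C^t$ is $N$-periodic under $T$ if $T^NC^t=C^t$ up to a global scalar. **The matrix $A$.** Let $\mathcal{M}$ be the finite quotient of $\mathbb{Z}^3$ by the subgroup generated by $(-N,0,0)$, $(-m,m,0)$, $(0,n,-n)$. The quantities $U^\mu,V^\mu,W^\mu$ and the series $G_p^\mu,G_q^\mu,G_r^\mu$ depend only on the class $[\mu]\in\mathcal{M}$. $A=(A_{[\mu],[\nu]})$ is the $\mathcal{M}\times\mathcal{M}$ matrix over $\mathbb{C}[x,y,z]$ such that, for every vector $(F^{[\mu]})_{[\mu]\in\mathcal{M}}$, the $[\mu]$-entry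 of $A(F^{[\nu]})_{[\nu]}$ is $$F^{[\mu]}+xyzF^{[\mu+(-1,-1,-1)]}-U^{[\mu]}(0,0,0)\left(xF^{[\mu+(-1,0,0)]}+yzF^{[\mu+(0,-1,-1)]}\right)-V^{[\mu]}(0,0,0)\left(yF^{[\mu+(0,-1,0)]}+xzF^{[\mu+(-1,0,-1)]}\right)-W^{[\mu]}(0,0,0)\left(zF^{[\mu+(0,0,-1)]}+xyF^{[\mu+(-1,-1,0)]}\right).$$ *)

theory Defs
  imports "HOL-Analysis.Analysis" "HOL-Computational_Algebra.Formal_Power_Series"
begin

type_synonym point = "int \<times> int \<times> int"

datatype dir = Da | Db | Dc

section \<open>Initial conditions and rhombi\<close>

definition octant :: "point set" where
  "octant = {(i, j, k). i \<le> 0 \<and> j \<le> 0 \<and> k \<le> 0}"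

definition lower_region :: "point set \<Rightarrow> bool" where
  "lower_region L \<longleftrightarrow> L \<subseteq> octant \<and> finite (octant - L) \<and>
     (\<forall>i j k i' j' k'. (i, j, k) \<in> L \<and> i' \<le> i \<and> j' \<le> j \<and> k' \<le> k \<longrightarrow> (i', j', k') \<in> L)"

definition region_boundary :: "point set \<Rightarrow> point set" where
  "region_boundary L = {(i, j, k). (i, j, k) \<in> L \<and> (i + 1, j + 1, k + 1) \<notin> L}"

definition initial_conditions :: "point set \<Rightarrow> bool" where
  "initial_conditions I \<longleftrightarrow> (\<exists>L. lower_region L \<and> I = region_boundary L)"

fun rhombus :: "dir \<Rightarrow> point \<Rightarrow> point set" where
  "rhombus Da (i, j, k) = {(i, j, k), (i, j - 1, k), (i, j, k - 1), (i, j - 1, k - 1)}"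
| "rhombus Db (i, j, k) = {(i, j, k), (i - 1, j, k), (i, j, k - 1), (i - 1, j, k - 1)}"
| "rhombus Dc (i, j, k) = {(i, j, k), (i - 1, j, k), (i, j - 1, k), (i - 1, j - 1, k)}"

fun long_diag :: "dir \<Rightarrow> point \<Rightarrow> point set" where
  "long_diag Da (i, j, k) = {(i, j - 1, k), (i, j, k - 1)}"
| "long_diag Db (i, j, k) = {(i - 1, j, k), (i, j, k - 1)}"
| "long_diag Dc (i, j, k) = {(i - 1, j, k), (i, j - 1, k)}"

fun short_diag :: "dir \<Rightarrow> point \<Rightarrow> point set" where
  "short_diag Da (i, j, k) = {(i, j, k), (i, j - 1, k - 1)}"
| "short_diag Db (i, j, k) = {(i, j, k), (i - 1, j, k - 1)}"
| "short_diag Dc (i, j, k) = {(i, j, k), (i - 1, j - 1, k)}"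

section \<open>Groves\<close>

text \<open>A graph is a pair of a vertex set and a set of edges, an edge being the set of its
  two endpoints. All diagonals are pairwise distinct as sets, so an edge determines its
  type, its direction and its base point.\<close>

type_synonym graph = "point set \<times> point set set"

definition components :: "graph \<Rightarrow> point set set" where
  "components G =
     fst G // {(u, v). u \<in> fst G \<and> v \<in> fst G \<and> (u, v) \<in> {(a, b). {a, b} \<in> snd G}\<^sup>*}"

definition Gamma_graph :: "point set \<Rightarrow> graph" where
  "Gamma_graph I = (I, {long_diag q v | q v. rhombus q v \<subseteq> I} \<union>
                       {short_diag q v | q v. rhombus q v \<subseteq> I})"

definition boundary_sets :: "int \<Rightarrow> point set set" where
  "boundary_sets M =
     {{(0, p, q), (p, 0, q)} | p q. 0 > p \<and> p > q \<and> p + q \<in> {- M - 1, - M - 2}} \<union>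
     {{(p, q, 0), (0, q, p)} | p q. 0 > p \<and> p > q \<and> p + q \<in> {- M - 1, - M - 2}} \<union>
     {{(q, 0, p), (q, p, 0)} | p q. 0 > p \<and> p > q \<and> p + q \<in> {- M - 1, - M - 2}} \<union>
     {{(0, p, p), (p, 0, p), (p, p, 0)} | p. 2 * p \<in> {- M - 1, - M - 2}} \<union>
     {{(0, 0, q)} | q. q \<le> - M - 1} \<union>
     {{(0, q, 0)} | q. q \<le> - M - 1} \<union>
     {{(q, 0, 0)} | q. q \<le> - M - 1}"

definition grove :: "point set \<Rightarrow> graph \<Rightarrow> bool" where
  "grove I G \<longleftrightarrow>
     fst G = I \<and> snd G \<subseteq> snd (Gamma_graph I) \<and>
     (\<forall>q v. rhombus q v \<subseteq> I \<longrightarrow> (long_diag q v \<in> snd G) \<noteq> (short_diag q v \<in> snd G)) \<and>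
     (\<exists>M::int. \<forall>q v. rhombus q v \<subseteq> I \<and> (\<forall>(i, j, k) \<in> rhombus q v. i + j + k < - M)
        \<longrightarrow> short_diag q v \<in> snd G) \<and>
     (\<forall>\<^sub>F M in at_top.
        (\<forall>K \<in> components G. \<exists>!S. S \<in> boundary_sets M \<and> S \<subseteq> K) \<and>
        (\<forall>S \<in> boundary_sets M. \<exists>K \<in> components G. S \<subseteq> K))"

definition groves :: "point set \<Rightarrow> graph set" where
  "groves I = {G. grove I G}"

section \<open>Conductances and edge probabilities\<close>

text \<open>\<open>C q v\<close> is the conductance of the long diagonal \<open>long_diag q v\<close>.\<close>

type_synonym conductance = "dir \<Rightarrow> point \<Rightarrow> real"

definition short_cond :: "conductance \<Rightarrow> conductance" where
  "short_cond C q v = 1 / C q v"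

definition YD_consistent :: "conductance \<Rightarrow> bool" where
  "YD_consistent C \<longleftrightarrow> (\<forall>i j k.
     let S = C Da (i, j, k) * C Db (i, j, k) + C Da (i, j, k) * C Dc (i, j, k)
             + C Db (i, j, k) * C Dc (i, j, k)
     in C Da (i, j, k) * short_cond C Da (i - 1, j, k) = S \<and>
        C Db (i, j, k) * short_cond C Db (i, j - 1, k) = S \<and>
        C Dc (i, j, k) * short_cond C Dc (i, j, k - 1) = S)"

text \<open>By the condition on far away rhombi, a grove has only finitely many long edges.\<close>

definition grove_weight :: "conductance \<Rightarrow> graph \<Rightarrow> real" where
  "grove_weight C G = (\<Prod>(q, v) \<in> {(q, v). long_diag q v \<in> snd G}. C q v)"

text \<open>There are only finitely many groves on given initial conditions, so the normalising
  constant is a finite sum.\<close>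

definition grove_measure :: "conductance \<Rightarrow> point set \<Rightarrow> graph measure" where
  "grove_measure C I =
     point_measure (groves I)
       (\<lambda>G. ennreal (grove_weight C G / (\<Sum>H \<in> groves I. grove_weight C H)))"

text \<open>The common value, over all initial conditions containing the rhombus, of the probability
  of the long diagonal. The arguments \<open>Da\<close>, \<open>Db\<close>, \<open>Dc\<close> give $p$, $q$, $r$ respectively.\<close>

definition edge_prob :: "conductance \<Rightarrow> dir \<Rightarrow> point \<Rightarrow> real" where
  "edge_prob C q v = (THE x. \<forall>I. initial_conditions I \<and> rhombus q v \<subseteq> I \<longrightarrow>
     x = measure (grove_measure C I) {G \<in> groves I. long_diag q v \<in> snd G})"

definition Delta_coef :: "conductance \<Rightarrow> point \<Rightarrow> real" where
  "Delta_coef C = (\<lambda>(i, j, k).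
     C Db (i, j - 1, k) * C Dc (i, j, k - 1) + C Da (i - 1, j, k) * C Dc (i, j, k - 1)
     + C Da (i - 1, j, k) * C Db (i, j - 1, k))"

definition U_coef :: "conductance \<Rightarrow> point \<Rightarrow> real" where
  "U_coef C = (\<lambda>(i, j, k). C Db (i, j - 1, k) * C Dc (i, j, k - 1) / Delta_coef C (i, j, k))"

definition V_coef :: "conductance \<Rightarrow> point \<Rightarrow> real" where
  "V_coef C = (\<lambda>(i, j, k). C Da (i - 1, j, k) * C Dc (i, j, k - 1) / Delta_coef C (i, j, k))"

definition W_coef :: "conductance \<Rightarrow> point \<Rightarrow> real" where
  "W_coef C = (\<lambda>(i, j, k). C Da (i - 1, j, k) * C Db (i, j - 1, k) / Delta_coef C (i, j, k))"

definition shift :: "conductance \<Rightarrow> point \<Rightarrow> conductance" where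
  "shift C \<mu> q v = C q (v + \<mu>)"

section \<open>Generating functions\<close>

text \<open>Formal power series in $x, y, z$ as iterated univariate series: \<open>z\<close> is the outermost
  variable and \<open>x\<close> the innermost one.\<close>

type_synonym fps3 = "complex fps fps fps"

definition X_var :: fps3 where "X_var = fps_const (fps_const fps_X)"
definition Y_var :: fps3 where "Y_var = fps_const fps_X"
definition Z_var :: fps3 where "Z_var = fps_X"

definition const3 :: "real \<Rightarrow> fps3" where
  "const3 a = fps_const (fps_const (fps_const (complex_of_real a)))"

lemma fps_mult_inverse_ring:
  fixes f :: "'a::{ring_1,inverse} fps"
  assumes "fps_nth f 0 * inverse (fps_nth f 0) = 1"
  shows "f * inverse f = 1"
  unfolding fps_inverse_def using fps_right_inverse [OF assms] .

text \<open>The library division is used below with the divisors \<open>1 - x\<close>, \<open>1 - y\<close>, \<open>1 - z\<close> only;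
  these are units, and the quotients are the ring-theoretic ones although the coefficient
  rings are not fields:\<close>

lemma geometric_quotients:
  "(1 - X_var) * (X_var / (1 - X_var)) = X_var"
  "(1 - Y_var) * (Y_var / (1 - Y_var)) = Y_var"
  "(1 - Z_var) * (Z_var / (1 - Z_var)) = Z_var"
proof -
  have quot: "(1 - v) * (v / (1 - v)) = v" if "(1 - v) * inverse (1 - v) = 1" "fps_nth (1 - v) 0 \<noteq> 0"
    for v :: fps3
  proof -
    have "v / (1 - v) = v * inverse (1 - v)"
      using that(2) by (intro fps_divide_unit)
    hence "(1 - v) * (v / (1 - v)) = v * ((1 - v) * inverse (1 - v))"
      by (simp only: mult.left_commute)
    thus ?thesis by (simp only: that(1) mult_1_right)
  qed
  have x1: "(1 - fps_X) * inverse (1 - fps_X) = (1 :: complex fps)"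
    by (rule fps_mult_inverse_ring) (simp add: fps_inverse_one')
  have y1: "(1 - fps_X) * inverse (1 - fps_X) = (1 :: complex fps fps)"
    by (rule fps_mult_inverse_ring) (simp add: fps_inverse_one')
  have x2: "(1 - fps_const fps_X) * inverse (1 - fps_const fps_X) = (1 :: complex fps fps)"
    by (rule fps_mult_inverse_ring) (simp add: x1)
  have nz: "1 - fps_X \<noteq> (0 :: complex fps fps)" "1 - fps_const fps_X \<noteq> (0 :: complex fps fps)"
    using y1 x2 by (metis mult_zero_left zero_neq_one)+
  show "(1 - X_var) * (X_var / (1 - X_var)) = X_var"
    by (rule quot; (rule fps_mult_inverse_ring)?) (simp_all add: X_var_def x2 nz fps_inverse_one')
  show "(1 - Y_var) * (Y_var / (1 - Y_var)) = Y_var"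
    by (rule quot; (rule fps_mult_inverse_ring)?) (simp_all add: Y_var_def y1 nz fps_inverse_one')
  show "(1 - Z_var) * (Z_var / (1 - Z_var)) = Z_var"
    by (rule quot; (rule fps_mult_inverse_ring)?) (simp_all add: Z_var_def fps_inverse_one')
qed

definition gen_series :: "(point \<Rightarrow> real) \<Rightarrow> fps3" where
  "gen_series f = Abs_fps (\<lambda>k. Abs_fps (\<lambda>j. Abs_fps (\<lambda>i.
     complex_of_real (f (- int i, - int j, - int k)))))"

definition edge_series :: "conductance \<Rightarrow> dir \<Rightarrow> point \<Rightarrow> fps3" where
  "edge_series C q \<mu> = gen_series (edge_prob (shift C \<mu>) q)"

section \<open>Conductances on $T_{m,n}$ and periodicity\<close>

text \<open>Only the values of \<open>Ct\<close> on the plane $i + j + k = 0$ are meaningful.\<close>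

definition torus_conductance :: "nat \<Rightarrow> nat \<Rightarrow> conductance \<Rightarrow> bool" where
  "torus_conductance m n Ct \<longleftrightarrow> (\<forall>q i j k. i + j + k = 0 \<longrightarrow>
     Ct q (i - int m, j + int m, k) = Ct q (i, j, k) \<and>
     Ct q (i, j + int n, k - int n) = Ct q (i, j, k))"

definition torus_positive :: "conductance \<Rightarrow> bool" where
  "torus_positive Ct \<longleftrightarrow> (\<forall>q i j k. i + j + k = 0 \<longrightarrow> Ct q (i, j, k) > 0)"

definition YD_extension :: "conductance \<Rightarrow> conductance" where
  "YD_extension Ct = (THE C. (\<forall>q v. C q v > 0) \<and> YD_consistent C \<and>
     (\<forall>q i j k. i + j + k = 0 \<longrightarrow> C q (i, j, k) = Ct q (i, j, k)))"

definition cluster_T :: "conductance \<Rightarrow> conductance" where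
  "cluster_T Ct = (\<lambda>q (i, j, k). YD_extension Ct q (i - 1, j, k))"

definition T_periodic :: "nat \<Rightarrow> conductance \<Rightarrow> bool" where
  "T_periodic N Ct \<longleftrightarrow> (\<exists>s>0. \<forall>q i j k. i + j + k = 0 \<longrightarrow>
     (cluster_T ^^ N) Ct q (i, j, k) = s * Ct q (i, j, k))"

section \<open>The quotient of $\mathbb{Z}^3$ and the matrix\<close>

definition period_lattice :: "nat \<Rightarrow> nat \<Rightarrow> nat \<Rightarrow> point set" where
  "period_lattice N m n =
     {(- a * int N - b * int m, b * int m + c * int n, - c * int n) | a b c. True}"

definition period_rel :: "nat \<Rightarrow> nat \<Rightarrow> nat \<Rightarrow> (point \<times> point) set" where
  "period_rel N m n = {(\<mu>, \<nu>). \<nu> - \<mu> \<in> period_lattice N m n}"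

definition period_classes :: "nat \<Rightarrow> nat \<Rightarrow> nat \<Rightarrow> point set set" where
  "period_classes N m n = UNIV // period_rel N m n"

definition class_shift :: "point set \<Rightarrow> point \<Rightarrow> point set" where
  "class_shift c d = (\<lambda>\<mu>. \<mu> + d) ` c"

text \<open>Value on a class of a function of the representative that is constant on the class.\<close>

definition on_class :: "(point \<Rightarrow> 'a) \<Rightarrow> point set \<Rightarrow> 'a" where
  "on_class f c = the_elem (f ` c)"

definition U_class :: "conductance \<Rightarrow> point set \<Rightarrow> real" where
  "U_class C = on_class (\<lambda>\<mu>. U_coef (shift C \<mu>) (0, 0, 0))"

definition V_class :: "conductance \<Rightarrow> point set \<Rightarrow> real" where
  "V_class C = on_class (\<lambda>\<mu>. V_coef (shift C \<mu>) (0, 0, 0))"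

definition W_class :: "conductance \<Rightarrow> point set \<Rightarrow> real" where
  "W_class C = on_class (\<lambda>\<mu>. W_coef (shift C \<mu>) (0, 0, 0))"

definition G_class :: "conductance \<Rightarrow> dir \<Rightarrow> point set \<Rightarrow> fps3" where
  "G_class C q = on_class (edge_series C q)"

text \<open>Several of the shifted classes may coincide; the corresponding contributions then add up.\<close>

definition A_matrix :: "conductance \<Rightarrow> point set \<Rightarrow> point set \<Rightarrow> fps3" where
  "A_matrix C c d = (let \<delta> = (\<lambda>e. of_bool (d = class_shift c e)) in
     \<delta> (0, 0, 0) + X_var * Y_var * Z_var * \<delta> (-1, -1, -1)
     - const3 (U_class C c) * (X_var * \<delta> (-1, 0, 0) + Y_var * Z_var * \<delta> (0, -1, -1))
     - const3 (V_class C c) * (Y_var * \<delta> (0, -1, 0) + X_var * Z_var * \<delta> (-1, 0, -1))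
     - const3 (W_class C c) * (Z_var * \<delta> (0, 0, -1) + X_var * Y_var * \<delta> (-1, -1, 0)))"

definition mat_apply ::
    "'i set \<Rightarrow> ('i \<Rightarrow> 'i \<Rightarrow> 'a::comm_ring_1) \<Rightarrow> ('i \<Rightarrow> 'a) \<Rightarrow> 'i \<Rightarrow> 'a" where
  "mat_apply S A F c = (\<Sum>d\<in>S. A c d * F d)"

lemma equiv_period_rel: "equiv UNIV (period_rel N m n)"
proof (rule equivI)
  show "refl (period_rel N m n)"
    unfolding refl_on_def period_rel_def period_lattice_def zero_prod_def
    by (auto intro!: exI [of _ "0::int"] simp: zero_prod_def)
  show "sym (period_rel N m n)"
  proof (rule symI)
    fix u v assume "(u, v) \<in> period_rel N m n"
    then obtain a b c where
      "v - u = (- a * int N - b * int m, b * int m + c * int n, - c * int n)"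
      by (auto simp: period_rel_def period_lattice_def)
    hence "u - v = (- (- a) * int N - (- b) * int m, (- b) * int m + (- c) * int n, - (- c) * int n)"
      by (cases u; cases v) auto
    thus "(v, u) \<in> period_rel N m n"
      unfolding period_rel_def period_lattice_def by blast
  qed
  show "trans (period_rel N m n)"
  proof (rule transI)
    fix u v w assume "(u, v) \<in> period_rel N m n" "(v, w) \<in> period_rel N m n"
    hence "\<exists>a b c. v - u = (- a * int N - b * int m, b * int m + c * int n, - c * int n)"
      "\<exists>a b c. w - v = (- a * int N - b * int m, b * int m + c * int n, - c * int n)"
      unfolding period_rel_def period_lattice_def by simp_all
    then obtain a b c a' b' c' where
      1: "v - u = (- a * int N - b * int m, b * int m + c * int n, - c * int n)" and
      2: "w - v = (- a' * int N - b' * int m, b' * int m + c' * int n, - c' * int n)"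
      by (elim exE)
    have "w - u = (w - v) + (v - u)" by simp
    hence "w - u = (- (a + a') * int N - (b + b') * int m,
                    (b + b') * int m + (c + c') * int n, - (c + c') * int n)"
      unfolding 1 2 by (simp add: algebra_simps)
    thus "(u, w) \<in> period_rel N m n"
      unfolding period_rel_def period_lattice_def by blast
  qed
qed auto

lemma finite_period_classes:
  assumes "N \<ge> 1" "m \<ge> 1" "n \<ge> 1"
  shows "finite (period_classes N m n)"
proof -
  let ?R = "period_rel N m n"
  let ?B = "{0..<int N} \<times> {0..<int m} \<times> {0..<int n}"
  have "\<exists>u\<in>?B. (u, v) \<in> ?R" for v
  proof -
    obtain i j k where v: "v = (i, j, k)" by (cases v)
    have div: "\<exists>q r. x = q * int d + r \<and> r \<in> {0..<int d}" if "d \<ge> 1" for x d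
    proof (intro exI conjI)
      show "x = x div int d * int d + x mod int d" by simp
    qed (use that in auto)
    obtain c k1 where k: "k = c * int n + k1" "k1 \<in> {0..<int n}"
      using div [OF assms(3)] by metis
    obtain b j1 where j: "j + c * int n = b * int m + j1" "j1 \<in> {0..<int m}"
      using div [OF assms(2)] by metis
    obtain a i1 where i: "i + b * int m = a * int N + i1" "i1 \<in> {0..<int N}"
      using div [OF assms(1)] by metis
    have "(i, j, k) - (i1, j1, k1) =
       (- (- a) * int N - b * int m, b * int m + (- c) * int n, - (- c) * int n)"
      unfolding diff_Pair prod.inject mult_minus_left minus_minus
      by (intro conjI) (use i(1) j(1) k(1) in linarith)+
    hence "((i1, j1, k1), v) \<in> ?R"
      unfolding period_rel_def period_lattice_def v by blast
    moreover have "(i1, j1, k1) \<in> ?B"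
      using i(2) j(2) k(2) by simp
    ultimately show ?thesis by blast
  qed
  note repr = this
  have "period_classes N m n \<subseteq> (\<lambda>u. ?R `` {u}) ` ?B"
  proof
    fix c assume "c \<in> period_classes N m n"
    then obtain v where v: "c = ?R `` {v}"
      unfolding period_classes_def by (elim quotientE)
    obtain u where "u \<in> ?B" "(u, v) \<in> ?R"
      using repr [of v] by blast
    thus "c \<in> (\<lambda>u. ?R `` {u}) ` ?B"
      using equiv_class_eq [OF equiv_period_rel] v by blast
  qed
  thus ?thesis by (rule finite_subset) auto
qed

lemma class_shift_in_classes:
  assumes "c \<in> period_classes N m n"
  shows "class_shift c d \<in> period_classes N m n"
proof -
  obtain u where u: "c = period_rel N m n `` {u}"
    using assms by (auto simp: period_classes_def quotient_def)
  have "class_shift c d = period_rel N m n `` {u + d}"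
  proof (intro equalityI subsetI)
    fix w assume "w \<in> period_rel N m n `` {u + d}"
    hence "w - d \<in> c" by (simp add: u period_rel_def algebra_simps)
    thus "w \<in> class_shift c d" unfolding class_shift_def by force
  qed (auto simp: class_shift_def u period_rel_def)
  thus ?thesis unfolding period_classes_def by (metis quotientI UNIV_I)
qed

text \<open>The property characterising the matrix:\<close>

lemma A_matrix_apply:
  assumes "N \<ge> 1" "m \<ge> 1" "n \<ge> 1" and c: "c \<in> period_classes N m n"
  shows "mat_apply (period_classes N m n) (A_matrix C) F c =
     F c + X_var * Y_var * Z_var * F (class_shift c (-1, -1, -1))
     - const3 (U_class C c) *
         (X_var * F (class_shift c (-1, 0, 0)) + Y_var * Z_var * F (class_shift c (0, -1, -1)))
     - const3 (V_class C c) *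
         (Y_var * F (class_shift c (0, -1, 0)) + X_var * Z_var * F (class_shift c (-1, 0, -1)))
     - const3 (W_class C c) *
         (Z_var * F (class_shift c (0, 0, -1)) + X_var * Y_var * F (class_shift c (-1, -1, 0)))"
proof -
  let ?S = "period_classes N m n"
  have pick: "(\<Sum>d\<in>?S. of_bool (d = class_shift c e) * F d) = F (class_shift c e)" for e
  proof -
    have "(\<Sum>d\<in>?S. of_bool (d = class_shift c e) * F d) =
          (\<Sum>d\<in>?S. if d = class_shift c e then F d else 0)"
      by (intro sum.cong) auto
    also have "\<dots> = F (class_shift c e)"
      using finite_period_classes [OF assms(1-3)] class_shift_in_classes [OF c] by simp
    finally show ?thesis .
  qed
  have "class_shift c (0, 0, 0) = c"
    by (auto simp: class_shift_def simp flip: zero_prod_def)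
  thus ?thesis
    unfolding mat_apply_def A_matrix_def Let_def
    using pick [of "(0, 0, 0)"]
    by (simp add: distrib_right distrib_left left_diff_distrib right_diff_distrib sum.distrib
          sum_subtractf pick mult.assoc flip: sum_distrib_left)
qed

end

theory Submission
  imports Defs
begin

text \<open>The edge probabilities satisfy a linear recurrence over the cubes of the lattice in which the
conductances enter only through \<open>U\<close>, \<open>V\<close> and \<open>W\<close>. The row of the system that belongs to a class
compares the solutions of this recurrence for eight neighbouring octants, and linearity does the
rest. Below, \<open>unit q\<close> is the unit vector of the direction \<open>q\<close>, the function \<open>coef C q\<close> is \<open>U\<close>, \<open>V\<close>
or \<open>W\<close>, and the probability of the long diagonal of type \<open>q\<close> at \<open>v\<close> is written \<open>P q v\<close>.

The recurrence. Removing a maximal point \<open>w\<close> from a lower region replaces the three rhombi on top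
of a cube by the three rhombi at its bottom. On the top, the short diagonals are edges of a star
centred at \<open>w\<close> and the long diagonals are edges of a triangle; at the bottom, star and triangle
have exchanged their outer vertices. Two configurations of these edges can be exchanged without
disturbing the connectivity of a grove (\<open>linked_star_triangle\<close>) when they have the same type: two
long diagonals on the top and none at the bottom, the same single long diagonal in both places, or
none on the top and two at the bottom. Three long diagonals never occur, since they isolate the
centre of the star. The star-triangle equations say exactly that the weights of the types on the
top are those at the bottom times a common factor. So both sets of initial conditions give the same
probability to every long diagonal away from the cube and to every type. On the top, the difference
between the sum of the three long edge probabilities and 1 is the probability of the type with two
long diagonals minus that of the type with none. Given that there are two, the coefficients \<open>U\<close>, \<open>V\<close>, \<open>W\<close>
are the conditional probabilities of the three pairs of long diagonals, and one obtains
(\<open>determined_lower\<close>)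
\<open>P q (v - unit q) = P q v + (1 - coef C q v) * (1 - P Da v - P Db v - P Dc v)\<close>.

Every lower region arises from the octant by finitely many such removals, and the initial
conditions of the octant itself carry a single grove, without long diagonals
(\<open>grove_tiles_octant\<close>). So the probabilities exist independently of the initial conditions, and
they are the solution \<open>edge_density\<close> of the recurrence that vanishes outside the octant.

The linear systems. A coefficient of the series at the class of \<open>\<mu> + e\<close>, multiplied by the monomial
of \<open>e\<close>, is a probability at a fixed rhombus of the full lattice, for the octant with apex \<open>\<mu> + e\<close>.
For every apex the probabilities, extended by zero, solve the same recurrence, with the indicator
function of the octant in place of the constant 1. The combination of the eight solutions in a row
of \<open>A\<close> therefore solves the recurrence whose source is the same combination of eight indicator
functions. As \<open>U + V + W = 1\<close>, this source is supported on the three edges of the octant, and the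
solution for it can be written down: it is \<open>1 - coef C q \<mu>\<close> on the open edge in direction \<open>q\<close>, and zero
elsewhere (\<open>cube_combination_density\<close>). Its generating function is the right hand side.

Periodicity. The extension \<open>C\<close> is in general not periodic, because the scalar of the periodicity
reappears inverted from one level to the next. But \<open>U\<close>, \<open>V\<close>, \<open>W\<close> are homogeneous of degree 0 in the
conductances of one level and are therefore periodic, and they determine the edge probabilities.\<close>

primrec unit :: "dir \<Rightarrow> point" where
  "unit Da = (1, 0, 0)"
| "unit Db = (0, 1, 0)"
| "unit Dc = (0, 0, 1)"

text \<open>The star-triangle equations relate the conductances on one
level to those on the next, and all recursions below run along the levels.\<close>

definition level :: "point \<Rightarrow> int" where
  "level = (\<lambda>(i, j, k). i + j + k)"

lemma level_simps [simp]:
  "level (u + v) = level u + level v"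
  "level (u - v) = level u - level v"
  "level (unit q) = 1"
  "level (i, j, k) = i + j + k"
  by (cases u; cases v; cases q; simp add: level_def)+

lemma UNIV_dir: "(UNIV :: dir set) = {Da, Db, Dc}"
  using dir.exhaust by auto

lemma all_dir: "(\<forall>q. P q) \<longleftrightarrow> P Da \<and> P Db \<and> P Dc"
  by (metis dir.exhaust)

section \<open>Conductances and the star-triangle equations\<close>

definition pair_sum :: "(dir \<Rightarrow> real) \<Rightarrow> real" where
  "pair_sum a = a Da * a Db + a Da * a Dc + a Db * a Dc"

lemma pair_sum_pos: "(\<And>q. a q > 0) \<Longrightarrow> pair_sum a > 0"
  unfolding pair_sum_def by (simp add: add_pos_pos)

lemma pair_sum_divide: "pair_sum (\<lambda>q. a q / s) = pair_sum a / s ^ 2"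
  by (simp add: pair_sum_def power2_eq_square add_divide_distrib)

lemma YD_consistent_iff:
  assumes "\<And>q v. C q v > 0"
  shows "YD_consistent C \<longleftrightarrow>
    (\<forall>q v. C q (v - unit q) = C q v / pair_sum (\<lambda>r. C r v))"
proof -
  have iff: "a * (1 / b) = s \<longleftrightarrow> b = a / s" if "a > 0" "b > 0" "s > 0" for a b s :: real
    using that by (auto simp: field_simps)
  have pos: "pair_sum (\<lambda>r. C r v) > 0" for v
    using assms by (rule pair_sum_pos)
  show ?thesis
    unfolding YD_consistent_def Let_def short_cond_def
    using iff [OF assms assms pos]
    by (simp add: all_dir split_paired_all pair_sum_def) blast
qed

lemma YD_consistent_downward:
  assumes pos: "\<And>q v. C q v > 0" and "YD_consistent C"
  shows "C q (v - unit q) = C q v / pair_sum (\<lambda>r. C r v)"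
  using assms(2) YD_consistent_iff [of C, OF pos] by blast

text \<open>The star-triangle transformation is an involution: \<open>C\<close> is recovered from its values one
  level below by the same formula.\<close>

lemma YD_consistent_upward:
  assumes pos: "\<And>q v. C q v > 0" and "YD_consistent C"
  shows "C q v = C q (v - unit q) / pair_sum (\<lambda>r. C r (v - unit r))"
proof -
  define s where "s = pair_sum (\<lambda>r. C r v)"
  have s: "s > 0" unfolding s_def using pos by (rule pair_sum_pos)
  have below: "C r (v - unit r) = C r v / s" for r
    unfolding s_def using assms by (rule YD_consistent_downward)
  have sum: "pair_sum (\<lambda>r. C r (v - unit r)) = s / s ^ 2"
    unfolding below pair_sum_divide by (simp add: s_def)
  show ?thesis unfolding sum unfolding below using s by (simp add: power2_eq_square)
qed

lemma YD_consistent_unique: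
  assumes C: "\<And>q v. C q v > 0" "YD_consistent C"
    and D: "\<And>q v. D q v > 0" "YD_consistent D"
    and plane: "\<And>q v. level v = 0 \<Longrightarrow> C q v = D q v"
  shows "C = D"
proof -
  have down: "level v = - int t \<Longrightarrow> C q v = D q v" for t q v
  proof (induction t arbitrary: q v)
    case (Suc t)
      have "C q v = C q (v + unit q) / pair_sum (\<lambda>r. C r (v + unit q))"
        using YD_consistent_downward [OF C, of q "v + unit q"] by simp
      also have "\<dots> = D q (v + unit q) / pair_sum (\<lambda>r. D r (v + unit q))"
        using Suc by simp
      also have "\<dots> = D q v"
        using YD_consistent_downward [OF D, of q "v + unit q"] by simp
      finally show ?case .
  qed (use plane in auto)
  have up: "level v = int t \<Longrightarrow> C q v = D q v" for t q v
  proof (induction t arbitrary: q v)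
    case (Suc t)
    show ?case
      unfolding YD_consistent_upward [OF C, of q v] YD_consistent_upward [OF D, of q v]
      using Suc by simp
  qed (use plane in auto)
  have "C q v = D q v" for q v
    using down [of v "nat (- level v)"] up [of v "nat (level v)"] by (cases "level v \<le> 0") auto
  thus ?thesis by blast
qed

text \<open>The extension of the values on the plane of level 0, level by level. \<open>YD_down Ct t\<close> is
  meaningful on level \<open>- t\<close> and \<open>YD_up Ct t\<close> on level \<open>t\<close>.\<close>

primrec YD_down :: "conductance \<Rightarrow> nat \<Rightarrow> conductance" where
  "YD_down Ct 0 = Ct"
| "YD_down Ct (Suc t) = (\<lambda>q v. YD_down Ct t q (v + unit q) /
     pair_sum (\<lambda>r. YD_down Ct t r (v + unit q)))"

primrec YD_up :: "conductance \<Rightarrow> nat \<Rightarrow> conductance" where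
  "YD_up Ct 0 = Ct"
| "YD_up Ct (Suc t) = (\<lambda>q v. YD_up Ct t q (v - unit q) /
     pair_sum (\<lambda>r. YD_up Ct t r (v - unit r)))"

lemma YD_extension_exists:
  assumes "torus_positive Ct"
  obtains C where "\<And>q v. C q v > 0" "YD_consistent C"
    "\<And>q v. level v = 0 \<Longrightarrow> C q v = Ct q v"
proof
  define C where "C = (\<lambda>q v. if level v \<le> 0 then YD_down Ct (nat (- level v)) q v
    else YD_up Ct (nat (level v)) q v)"
  have plane: "Ct q v > 0" if "level v = 0" for q v
    using assms that by (cases v) (auto simp: torus_positive_def)
  have down: "level v = - int t \<Longrightarrow> YD_down Ct t q v > 0" for t q v
    by (induction t arbitrary: q v) (simp_all add: plane divide_pos_pos pair_sum_pos)
  have up: "level v = int t \<Longrightarrow> YD_up Ct t q v > 0" for t q v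
    by (induction t arbitrary: q v) (simp_all add: plane divide_pos_pos pair_sum_pos)
  show pos: "C q v > 0" for q v
    using down [of v "nat (- level v)"] up [of v "nat (level v)"] by (auto simp: C_def)
  have "C q (v - unit q) = C q v / pair_sum (\<lambda>r. C r v)" for q v
  proof (cases "level v \<le> 0")
    case True
    hence "nat (- level (v - unit q)) = Suc (nat (- level v))" by simp
    thus ?thesis using True by (simp add: C_def)
  next
    case False
    hence suc: "nat (level v) = Suc (nat (level v - 1))" by simp
    define s where "s = pair_sum (\<lambda>r. C r (v - unit r))"
    have s: "s > 0" unfolding s_def by (intro pair_sum_pos pos)
    have below: "C r (v - unit r) = YD_up Ct (nat (level v - 1)) r (v - unit r)" for r
      using False by (auto simp: C_def)
    have at: "C r v = C r (v - unit r) / s" for r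
      unfolding s_def below using False by (simp add: C_def suc)
    hence "pair_sum (\<lambda>r. C r v) = s / s ^ 2"
      by (simp add: pair_sum_divide) (simp add: s_def)
    thus ?thesis using s by (simp add: at [of q] power2_eq_square)
  qed
  thus "YD_consistent C" using YD_consistent_iff [of C, OF pos] by blast
  show "C q v = Ct q v" if "level v = 0" for q v
    using that by (simp add: C_def)
qed

lemma YD_extension_eqI:
  assumes "\<And>q v. C q v > 0" "YD_consistent C" "\<And>q v. level v = 0 \<Longrightarrow> C q v = Ct q v"
  shows "YD_extension Ct = C"
  unfolding YD_extension_def
proof (rule the_equality)
  fix D assume D: "(\<forall>q v. 0 < D q v) \<and> YD_consistent D \<and>
    (\<forall>q i j k. i + j + k = 0 \<longrightarrow> D q (i, j, k) = Ct q (i, j, k))"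
  show "D = C"
    by (rule YD_consistent_unique) (use D assms in \<open>auto simp: split_paired_all\<close>)
qed (use assms in auto)

lemma YD_extension_properties:
  assumes "torus_positive Ct"
  shows "YD_extension Ct q v > 0" "YD_consistent (YD_extension Ct)"
    "level v = 0 \<Longrightarrow> YD_extension Ct q v = Ct q v"
  using YD_extension_exists [OF assms] YD_extension_eqI by metis+

lemma YD_consistent_shift:
  assumes "\<And>q v. C q v > 0" "YD_consistent C"
  shows "YD_consistent (shift C \<mu>)"
proof -
  have "C q (v - unit q + \<mu>) = C q (v + \<mu>) / pair_sum (\<lambda>r. C r (v + \<mu>))" for q v
    using YD_consistent_downward [OF assms, of q "v + \<mu>"] by (simp add: algebra_simps)
  thus ?thesis
    using assms(1) by (subst YD_consistent_iff) (auto simp: shift_def)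
qed

section \<open>Periodicity\<close>

primrec coef :: "conductance \<Rightarrow> dir \<Rightarrow> point \<Rightarrow> real" where
  "coef C Da = U_coef C"
| "coef C Db = V_coef C"
| "coef C Dc = W_coef C"

lemma coef_shift: "coef (shift C \<mu>) q v = coef C q (v + \<mu>)"
  by (cases q; cases v; cases \<mu>)
    (simp_all add: U_coef_def V_coef_def W_coef_def Delta_coef_def shift_def algebra_simps)

lemma coef_sum:
  assumes "\<And>q v. C q v > 0"
  shows "coef C Da v + coef C Db v + coef C Dc v = 1"
proof (cases v)
  case (fields i j k)
  have "Delta_coef C (i, j, k) > 0"
    unfolding Delta_coef_def by (simp add: assms add_pos_pos)
  thus ?thesis
    by (simp add: fields U_coef_def V_coef_def W_coef_def Delta_coef_def add_divide_distrib [symmetric]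
      add_ac)
qed

text \<open>A common factor on every level cancels in the coefficients, which are quotients of
  products of conductances on one level. This is why the coefficients are periodic although a
  periodic conductance on the torus is reproduced only up to a scalar, and why the scalar is
  inverted from one level to the next.\<close>

lemma coef_level_scale:
  assumes "\<And>q v. D q v = s (level v) * C q v" "\<And>l. s l \<noteq> 0"
  shows "coef D q v = coef C q v"
proof (cases v)
  case (fields i j k)
  define t where "t = s (i + j + k - 1)"
  have t: "t \<noteq> 0" using assms(2) by (simp add: t_def)
  have D: "D Da (i - 1, j, k) = t * C Da (i - 1, j, k)"
     "D Db (i, j - 1, k) = t * C Db (i, j - 1, k)" "D Dc (i, j, k - 1) = t * C Dc (i, j, k - 1)"
    by (simp_all add: assms(1) t_def algebra_simps)
  have c: "(t * a) * (t * b) = t ^ 2 * (a * b)" for a b by (simp add: power2_eq_square)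
  show ?thesis unfolding fields
    using t by (cases q)
     (simp_all add: U_coef_def V_coef_def W_coef_def Delta_coef_def D c distrib_left [symmetric])
qed

text \<open>The extension is unique, so it inherits the symmetries of the values on the plane.\<close>

lemma torus_extension_translate:
  assumes pos: "torus_positive Ct" and \<mu>: "level \<mu> = 0"
    and per: "\<And>q v. level v = 0 \<Longrightarrow> Ct q (v + \<mu>) = Ct q v"
  shows "shift (YD_extension Ct) \<mu> = YD_extension Ct"
  using YD_extension_properties [OF pos] \<mu> per
  by (intro YD_extension_eqI [symmetric] YD_consistent_shift) (auto simp: shift_def)

lemma cluster_T_power:
  assumes "torus_positive Ct" and "level v = 0"
  shows "(cluster_T ^^ t) Ct q v = YD_extension Ct q (v - (int t, 0, 0))"
  using assms(2)
proof (induction t arbitrary: q v)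
  case 0
  thus ?case using YD_extension_properties(3) [OF assms(1)] by (simp flip: zero_prod_def)
next
  case (Suc t)
  have "YD_extension ((cluster_T ^^ t) Ct) = shift (YD_extension Ct) (- (int t, 0, 0))"
    using YD_extension_properties [OF assms(1)] Suc.IH
    by (intro YD_extension_eqI YD_consistent_shift) (auto simp: shift_def)
  moreover have "cluster_T D q v = YD_extension D q (v - (1, 0, 0))" for D
    by (cases v) (simp add: cluster_T_def)
  ultimately show ?case
    by (cases v) (simp add: shift_def algebra_simps)
qed

text \<open>Multiplying the conductances on the plane by \<open>s\<close> multiplies those of the extension by \<open>s\<close>
on the even levels and by \<open>1/s\<close> on the odd ones. By uniqueness, the extension translated by
\<open>N\<close> in the first coordinate is of this form.\<close>

lemma coef_T_periodic:
  assumes "torus_positive Ct" "T_periodic N Ct"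
  shows "coef (YD_extension Ct) q (v - (int N, 0, 0)) = coef (YD_extension Ct) q v"
proof -
  define C where "C = YD_extension Ct"
  note C = YD_extension_properties [OF assms(1), folded C_def]
  obtain s where s: "s > 0" "\<And>q v. level v = 0 \<Longrightarrow> C q (v - (int N, 0, 0)) = s * C q v"
    using assms(2) cluster_T_power [OF assms(1), folded C_def] C(3)
    unfolding T_periodic_def by (auto simp: split_paired_all)
  \<comment> \<open>One step down divides all conductances by a quadratic expression, which inverts the factor.\<close>
  define f where "f l = (if even l then s else 1 / s)" for l :: int
  define D where "D = (\<lambda>q v. f (level v) * C q v)"
  have f: "f l > 0" "f (l - 1) = 1 / f l" for l using s(1) by (auto simp: f_def)
  have D: "D q v > 0" for q v using f C(1) by (simp add: D_def)
  have "D q (v - unit q) = D q v / pair_sum (\<lambda>r. D r v)" for q v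
  proof -
    have "pair_sum (\<lambda>r. D r v) = f (level v) ^ 2 * pair_sum (\<lambda>r. C r v)"
      by (simp add: D_def pair_sum_def power2_eq_square algebra_simps)
    moreover have "C q (v - unit q) = C q v / pair_sum (\<lambda>r. C r v)"
      using C(1,2) by (rule YD_consistent_downward)
    ultimately show ?thesis
      using f(1) [of "level v"] by (simp add: D_def f(2) power2_eq_square)
  qed
  hence "YD_consistent D" using YD_consistent_iff [of D, OF D] by blast
  hence "shift C (- (int N, 0, 0)) = D"
    using D C YD_consistent_shift s(2)
    by (intro YD_consistent_unique) (auto simp: shift_def D_def f_def)
  hence "coef (shift C (- (int N, 0, 0))) q v = coef C q v"
    using coef_level_scale [of D f C] f(1) by (simp add: D_def less_imp_neq [symmetric])
  thus ?thesis unfolding coef_shift C_def by (cases v) simp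
qed

lemma coef_periodic:
  assumes pos: "torus_positive Ct" and "torus_conductance m n Ct" "T_periodic N Ct"
    and "(\<mu>, \<nu>) \<in> period_rel N m n"
  shows "coef (YD_extension Ct) q (v + \<mu>) = coef (YD_extension Ct) q (v + \<nu>)"
proof -
  define c where "c = coef (YD_extension Ct) q"
  have iter: "c (v + (a * x, a * y, a * z)) = c v" if "\<And>v. c (v + (x, y, z)) = c v"
    for a x y z :: int and v
  proof (induction a arbitrary: v rule: int_induct [where k = 0])
    case (step1 a)
    have "v + ((a + 1) * x, (a + 1) * y, (a + 1) * z) = v + (a * x, a * y, a * z) + (x, y, z)"
      by (cases v) (simp add: algebra_simps)
    thus ?case using step1 that by metis
  next
    case (step2 a)
    have "v + ((a - 1) * x, (a - 1) * y, (a - 1) * z) + (x, y, z) = v + (a * x, a * y, a * z)"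
      by (cases v) (simp add: algebra_simps)
    thus ?case using step2 that by metis
  qed (simp flip: zero_prod_def)
  have torus: "c (v + \<kappa>) = c v" if "level \<kappa> = 0"
    "\<And>q v. level v = 0 \<Longrightarrow> Ct q (v + \<kappa>) = Ct q v" for \<kappa> v
    using torus_extension_translate [OF pos that] coef_shift [of "YD_extension Ct" \<kappa>]
    by (simp add: c_def)
  have 1: "c (v + (- int m, int m, 0)) = c v" for v
    by (rule torus) (use assms(2) in \<open>auto simp: torus_conductance_def\<close>)
  have 2: "c (v + (0, int n, - int n)) = c v" for v
    by (rule torus) (use assms(2) in \<open>auto simp: torus_conductance_def\<close>)
  have 3: "c (v + (- int N, 0, 0)) = c v" for v
    using coef_T_periodic [OF pos assms(3), of q v] by (cases v) (simp add: c_def)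
  obtain x y z where "\<nu> - \<mu> =
      (- x * int N - y * int m, y * int m + z * int n, - z * int n)"
    using assms(4) by (auto simp: period_rel_def period_lattice_def)
  hence "v + \<nu> = v + \<mu> + (x * (- int N), x * 0, x * 0) + (y * (- int m), y * int m, y * 0)
     + (z * 0, z * int n, z * (- int n))"
    by (cases v; cases \<mu>; cases \<nu>) (auto simp: algebra_simps)
  thus ?thesis
    using iter [OF 1] iter [OF 2] iter [OF 3] by (metis c_def)
qed

section \<open>The recurrence for the edge probabilities\<close>

lemma octant_iff: "(i, j, k) \<in> octant \<longleftrightarrow> i \<le> 0 \<and> j \<le> 0 \<and> k \<le> 0"
  by (simp add: octant_def)

lemma octant_level: "v \<in> octant \<Longrightarrow> level v \<le> 0"
  by (cases v) (simp add: octant_iff)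

lemma octant_unit: "v + unit q \<in> octant \<Longrightarrow> v \<in> octant"
  by (cases v; cases q) (auto simp: octant_iff)

text \<open>The solution, for the coefficients \<open>u\<close>, of the recurrence for the edge probabilities in the
octant. A rhombus of type \<open>q\<close> at a point whose coordinate in direction \<open>q\<close> is 0 is never crossed by
a long diagonal, so the value 0 there is the initial condition.\<close>

function edge_density :: "(dir \<Rightarrow> point \<Rightarrow> real) \<Rightarrow> dir \<Rightarrow> point \<Rightarrow> real" where
  "edge_density u q v =
    (if v + unit q \<in> octant then
       edge_density u q (v + unit q) + (1 - u q (v + unit q)) *
         (1 - edge_density u Da (v + unit q) - edge_density u Db (v + unit q) - edge_density u Dc (v + unit q))
     else 0)"
  by auto
termination
proof (relation "Wellfounded.measure (\<lambda>(u, q, v). nat (- level v))", goal_cases)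
qed (auto dest!: octant_level)

declare edge_density.simps [simp del]

lemma edge_density_outside: "v \<notin> octant \<Longrightarrow> edge_density u q v = 0"
  by (subst edge_density.simps) (auto dest: octant_unit)

text \<open>With the indicator function of the octant in place of the constant 1, the recurrence holds
on the whole lattice: outside the octant both sides vanish. This form makes it possible to combine
the solutions for different octants.\<close>

lemma edge_density_step:
  "edge_density u q (v - unit q) = edge_density u q v + (1 - u q v) *
     (of_bool (v \<in> octant) - edge_density u Da v - edge_density u Db v - edge_density u Dc v)"
  by (subst edge_density.simps) (auto simp: edge_density_outside)

lemma edge_density_shifted_step:
  "edge_density (\<lambda>r x. u r (x + \<tau>)) q (v - unit q - \<tau>) =
     edge_density (\<lambda>r x. u r (x + \<tau>)) q (v - \<tau>) + (1 - u q v) *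
       (of_bool (v - \<tau> \<in> octant) - edge_density (\<lambda>r x. u r (x + \<tau>)) Da (v - \<tau>)
         - edge_density (\<lambda>r x. u r (x + \<tau>)) Db (v - \<tau>) - edge_density (\<lambda>r x. u r (x + \<tau>)) Dc (v - \<tau>))"
proof -
  have "v - unit q - \<tau> = (v - \<tau>) - unit q" by simp
  thus ?thesis
    using edge_density_step [of "\<lambda>r x. u r (x + \<tau>)" q "v - \<tau>"] by (simp only: diff_add_cancel)
qed

lemma edge_density_recurrence_unique:
  fixes P R :: "dir \<Rightarrow> point \<Rightarrow> real"
  assumes zero: "\<And>q v. level v > 0 \<Longrightarrow> P q v = R q v"
    and P: "\<And>q v. P q (v - unit q) = P q v + (1 - u q v) * (\<eta> v - P Da v - P Db v - P Dc v)"
    and R: "\<And>q v. R q (v - unit q) = R q v + (1 - u q v) * (\<eta> v - R Da v - R Db v - R Dc v)"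
  shows "P q v = R q v"
proof (induction "nat (1 - level v)" arbitrary: q v)
  case 0
  thus ?case by (intro zero) simp
next
  case (Suc t)
  have "P r (v + unit q) = R r (v + unit q)" for r
    using Suc.hyps(2) by (intro Suc.hyps(1)) simp
  thus ?case
    using P [of q "v + unit q"] R [of q "v + unit q"] by simp
qed

primrec on_axis :: "dir \<Rightarrow> point \<Rightarrow> bool" where
  "on_axis Da = (\<lambda>(i, j, k). i < 0 \<and> j = 0 \<and> k = 0)"
| "on_axis Db = (\<lambda>(i, j, k). j < 0 \<and> i = 0 \<and> k = 0)"
| "on_axis Dc = (\<lambda>(i, j, k). k < 0 \<and> i = 0 \<and> j = 0)"

text \<open>The linear combination of the values \<open>F e\<close> at the shifts \<open>e\<close> in a row of the matrix \<open>A\<close>, without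
  the monomials, which only adjust the positions of the coefficients.\<close>

definition cube_combination :: "(dir \<Rightarrow> real) \<Rightarrow> (point \<Rightarrow> real) \<Rightarrow> real" where
  "cube_combination w F = F (0, 0, 0) + F (-1, -1, -1)
     - w Da * (F (-1, 0, 0) + F (0, -1, -1))
     - w Db * (F (0, -1, 0) + F (-1, 0, -1))
     - w Dc * (F (0, 0, -1) + F (-1, -1, 0))"

text \<open>The combination of eight translated octants that occurs in the matrix almost cancels: at
interior points the coefficients add up to \<open>2 - 2(U + V + W) = 0\<close>, inside a face to
\<open>1 - (U + V + W) = 0\<close>, and only the three edges of the octant remain.\<close>

lemma cube_combination_octants:
  assumes "w Da + w Db + w Dc = 1"
  shows "cube_combination w (\<lambda>\<tau>. of_bool (v - \<tau> \<in> octant)) =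
    of_bool (v = (0, 0, 0)) + of_bool (on_axis Da v) * (1 - w Da)
      + of_bool (on_axis Db v) * (1 - w Db) + of_bool (on_axis Dc v) * (1 - w Dc)"
proof (cases v)
  case (fields i j k)
  have w: "w Dc = 1 - w Da - w Db" using assms by linarith
  \<comment> \<open>The indicator of a nonpositive coordinate is \<open>neg + zer\<close> for the octant and \<open>neg\<close> for its translate.
    In these terms the claim is an identity of polynomials.\<close>
  define neg zer :: "int \<Rightarrow> real" where "neg = (\<lambda>x. of_bool (x < 0))" and "zer = (\<lambda>x. of_bool (x = 0))"
  have split: "of_bool (x \<le> 0) = neg x + zer x" "of_bool (x < 0) = neg x" "of_bool (x = 0) = zer x" for x
    by (auto simp: neg_def zer_def)
  show ?thesis
    unfolding fields cube_combination_def w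
    by (simp add: octant_iff add1_zle_eq of_bool_conj split) (simp add: algebra_simps)
qed

text \<open>Both sides solve the recurrence with the source of the preceding lemma and vanish on
positive levels. For the right hand side, the source minus the sum of the three densities is 1 at
the apex and 0 elsewhere, so each density is produced in the first step and then stays constant
along its axis.\<close>

lemma cube_combination_density:
  assumes "u Da (0, 0, 0) + u Db (0, 0, 0) + u Dc (0, 0, 0) = 1"
  shows "cube_combination (\<lambda>r. u r (0, 0, 0)) (\<lambda>\<tau>. edge_density (\<lambda>r x. u r (x + \<tau>)) q (v - \<tau>)) =
    of_bool (on_axis q v) * (1 - u q (0, 0, 0))"
proof (rule edge_density_recurrence_unique [where u = u and
    P = "\<lambda>q v. cube_combination (\<lambda>r. u r (0, 0, 0))
      (\<lambda>\<tau>. edge_density (\<lambda>r x. u r (x + \<tau>)) q (v - \<tau>))" and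
    R = "\<lambda>q v. of_bool (on_axis q v) * (1 - u q (0, 0, 0))" and
    \<eta> = "\<lambda>v. cube_combination (\<lambda>r. u r (0, 0, 0)) (\<lambda>\<tau>. of_bool (v - \<tau> \<in> octant))"])
  define w where "w = (\<lambda>r. u r (0, 0, 0))"
  have w: "w Da + w Db + w Dc = 1" using assms by (simp add: w_def)
  fix q v
  show "cube_combination (\<lambda>r. u r (0, 0, 0)) (\<lambda>\<tau>. edge_density (\<lambda>r x. u r (x + \<tau>)) q (v - \<tau>)) =
      of_bool (on_axis q v) * (1 - u q (0, 0, 0))" if v: "level v > 0"
  proof -
    have "edge_density (\<lambda>r x. u r (x + \<tau>)) q (v - \<tau>) = 0" if "level \<tau> \<le> 0" for \<tau>
      using v that octant_level [of "v - \<tau>"] by (intro edge_density_outside) auto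
    moreover have "\<not> on_axis q v"
      using v by (cases q; cases v) auto
    ultimately show ?thesis by (simp add: cube_combination_def)
  qed
  show "cube_combination (\<lambda>r. u r (0, 0, 0)) (\<lambda>\<tau>. edge_density (\<lambda>r x. u r (x + \<tau>)) q (v - unit q - \<tau>)) =
     cube_combination (\<lambda>r. u r (0, 0, 0)) (\<lambda>\<tau>. edge_density (\<lambda>r x. u r (x + \<tau>)) q (v - \<tau>))
     + (1 - u q v) * (cube_combination (\<lambda>r. u r (0, 0, 0)) (\<lambda>\<tau>. of_bool (v - \<tau> \<in> octant))
     - cube_combination (\<lambda>r. u r (0, 0, 0)) (\<lambda>\<tau>. edge_density (\<lambda>r x. u r (x + \<tau>)) Da (v - \<tau>))
     - cube_combination (\<lambda>r. u r (0, 0, 0)) (\<lambda>\<tau>. edge_density (\<lambda>r x. u r (x + \<tau>)) Db (v - \<tau>))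
     - cube_combination (\<lambda>r. u r (0, 0, 0)) (\<lambda>\<tau>. edge_density (\<lambda>r x. u r (x + \<tau>)) Dc (v - \<tau>)))"
    unfolding edge_density_shifted_step by (simp add: cube_combination_def algebra_simps)
  have eq: "cube_combination (\<lambda>r. u r (0, 0, 0)) (\<lambda>\<tau>. of_bool (v - \<tau> \<in> octant))
      - of_bool (on_axis Da v) * (1 - u Da (0, 0, 0))
      - of_bool (on_axis Db v) * (1 - u Db (0, 0, 0))
      - of_bool (on_axis Dc v) * (1 - u Dc (0, 0, 0)) = of_bool (v = (0, 0, 0))"
    unfolding cube_combination_octants [of w v, OF w, unfolded w_def] by simp
  have "on_axis q (v - unit q) \<longleftrightarrow> on_axis q v \<or> v = (0, 0, 0)"
    "\<not> (on_axis q v \<and> v = (0, 0, 0))"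
    by (cases v; cases q; auto)+
  thus "of_bool (on_axis q (v - unit q)) * (1 - u q (0, 0, 0)) =
    of_bool (on_axis q v) * (1 - u q (0, 0, 0)) + (1 - u q v) *
      (cube_combination (\<lambda>r. u r (0, 0, 0)) (\<lambda>\<tau>. of_bool (v - \<tau> \<in> octant))
      - of_bool (on_axis Da v) * (1 - u Da (0, 0, 0))
      - of_bool (on_axis Db v) * (1 - u Db (0, 0, 0))
      - of_bool (on_axis Dc v) * (1 - u Dc (0, 0, 0)))"
    unfolding eq by (cases "v = (0, 0, 0)") auto
qed

section \<open>Generating functions\<close>

lemma gen_series_nth [simp]:
  "fps_nth (fps_nth (fps_nth (gen_series f) k) j) i = complex_of_real (f (- int i, - int j, - int k))"
  by (simp add: gen_series_def)

lemma fps3_eqI: "(\<And>i j k. fps_nth (fps_nth (fps_nth F k) j) i = fps_nth (fps_nth (fps_nth G k) j) i) \<Longrightarrow>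
    F = (G :: fps3)"
  by (intro fps_ext) auto

lemma gen_series_cong: "(\<And>v. v \<in> octant \<Longrightarrow> f v = g v) \<Longrightarrow> gen_series f = gen_series g"
  by (intro fps3_eqI) (simp add: octant_iff)

lemma gen_series_add: "gen_series f + gen_series g = gen_series (\<lambda>v. f v + g v)"
  by (intro fps3_eqI) simp

lemma gen_series_diff: "gen_series f - gen_series g = gen_series (\<lambda>v. f v - g v)"
  by (intro fps3_eqI) simp

lemma const3_mult_gen_series: "const3 a * gen_series f = gen_series (\<lambda>v. a * f v)"
  by (intro fps3_eqI) (simp add: const3_def)

primrec var :: "dir \<Rightarrow> fps3" where
  "var Da = X_var" | "var Db = Y_var" | "var Dc = Z_var"

lemma var_mult_gen_series:
  assumes "\<And>v. v \<notin> octant \<Longrightarrow> f v = 0"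
  shows "var q * gen_series f = gen_series (\<lambda>v. f (v + unit q))"
  using assms
  by (cases q; intro fps3_eqI)
    (auto simp: X_var_def Y_var_def Z_var_def octant_iff of_nat_diff algebra_simps)

lemma var_geometric: "var q / (1 - var q) = gen_series (\<lambda>v. of_bool (on_axis q v))"
proof -
  have out: "(of_bool (on_axis q v) :: real) = 0" if "v \<notin> octant" for v
    using that by (cases q; cases v) (auto simp: octant_iff)
  have shift: "var q * gen_series (\<lambda>v. of_bool (on_axis q v)) =
      gen_series (\<lambda>v. of_bool (on_axis q (v + unit q)))"
    by (rule var_mult_gen_series) (rule out)
  have "(1 - var q) * gen_series (\<lambda>v. of_bool (on_axis q v)) =
    gen_series (\<lambda>v. of_bool (on_axis q v) - of_bool (on_axis q (v + unit q)))"
    unfolding left_diff_distrib shift gen_series_diff mult_1_left ..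
  also have "\<dots> = var q"
    by (intro fps3_eqI; cases q)
      (auto simp: X_var_def Y_var_def Z_var_def of_bool_def fps_X_nth)
  also have geometric: "\<dots> = (1 - var q) * (var q / (1 - var q))"
    using geometric_quotients by (cases q) simp_all
  finally have "(1 - var q) * gen_series (\<lambda>v. of_bool (on_axis q v)) =
      (1 - var q) * (var q / (1 - var q))" .
  moreover have "1 - var q \<noteq> 0"
  proof
    assume "1 - var q = 0"
    thus False using geometric by (metis eq_iff_diff_eq_0 mult_zero_left zero_neq_one)
  qed
  ultimately show ?thesis by (metis mult_left_cancel)
qed

declare split_paired_All [simp del] split_paired_Ex [simp del]

section \<open>Groves as sets of long diagonals\<close>

type_synonym tile = "dir \<times> point"

definition tiles :: "point set \<Rightarrow> tile set" where
  "tiles I = {(q, v). rhombus q v \<subseteq> I}"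

text \<open>Every grove is of this form for a finite set \<open>A\<close>: the choice of exactly one diagonal in each
rhombus is built in, and only the condition on the components remains.\<close>

definition tile_graph :: "point set \<Rightarrow> tile set \<Rightarrow> graph" where
  "tile_graph I A = (I, (\<lambda>(q, v). long_diag q v) ` A \<union> (\<lambda>(q, v). short_diag q v) ` (tiles I - A))"

lemma long_diag_eq_iff [simp]: "long_diag q v = long_diag r w \<longleftrightarrow> q = r \<and> v = w"
  by (cases v; cases w; cases q; cases r) (auto simp: doubleton_eq_iff)

lemma short_diag_eq_iff [simp]: "short_diag q v = short_diag r w \<longleftrightarrow> q = r \<and> v = w"
  by (cases v; cases w; cases q; cases r) (auto simp: doubleton_eq_iff)

lemma long_diag_neq_short_diag [simp]: "long_diag q v \<noteq> short_diag r w" "short_diag r w \<noteq> long_diag q v"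
  by (cases v; cases w; cases q; cases r; auto simp: doubleton_eq_iff)+

lemma long_diag_in_tile_graph [simp]: "long_diag q v \<in> snd (tile_graph I A) \<longleftrightarrow> (q, v) \<in> A"
  by (auto simp: tile_graph_def)

lemma short_diag_in_tile_graph [simp]:
  "short_diag q v \<in> snd (tile_graph I A) \<longleftrightarrow> (q, v) \<in> tiles I - A"
  by (auto simp: tile_graph_def)

lemma top_in_rhombus: "v \<in> rhombus q v"
  by (cases v; cases q) auto

lemma rhombus_level: "u \<in> rhombus q v \<Longrightarrow> level u \<le> level v"
  by (cases v; cases q) auto

lemma long_diag_subset_rhombus: "long_diag q v \<subseteq> rhombus q v"
  by (cases v; cases q) auto

lemma short_diag_subset_rhombus: "short_diag q v \<subseteq> rhombus q v"
  by (cases v; cases q) auto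

lemma finite_octant_above: "finite {v \<in> octant. level v \<ge> l}"
proof (rule finite_subset)
  show "{v \<in> octant. level v \<ge> l} \<subseteq> {l..0} \<times> {l..0} \<times> {l..0}"
    by (auto simp: octant_iff)
qed auto

text \<open>The connectivity condition on groves, with reachability in place of components.\<close>

definition joined :: "'a set set \<Rightarrow> ('a \<times> 'a) set" where
  "joined E = {(a, b). {a, b} \<in> E}\<^sup>*"

definition linked :: "'a set set \<Rightarrow> 'a set \<Rightarrow> 'a set set \<Rightarrow> bool" where
  "linked B V E \<longleftrightarrow>
     (\<forall>u\<in>V. \<exists>!S. S \<in> B \<and> (\<forall>s\<in>S. s \<in> V \<and> (u, s) \<in> joined E)) \<and>
     (\<forall>S\<in>B. \<exists>u\<in>V. \<forall>s\<in>S. s \<in> V \<and> (u, s) \<in> joined E)"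

lemma components_linked:
  "(\<forall>K\<in>components (V, E). \<exists>!S. S \<in> B \<and> S \<subseteq> K) \<and> (\<forall>S\<in>B. \<exists>K\<in>components (V, E). S \<subseteq> K) \<longleftrightarrow>
     linked B V E"
proof -
  have "components (V, E) = (\<lambda>u. {s \<in> V. (u, s) \<in> joined E}) ` V"
    by (auto simp: components_def quotient_def joined_def)
  moreover have "S \<subseteq> {s \<in> V. (u, s) \<in> joined E} \<longleftrightarrow> (\<forall>s\<in>S. s \<in> V \<and> (u, s) \<in> joined E)" for S u
    by blast
  ultimately show ?thesis by (simp add: linked_def)
qed

definition grove_tiles :: "point set \<Rightarrow> tile set set" where
  "grove_tiles I = {A. A \<subseteq> tiles I \<and> finite A \<and>
     (\<forall>\<^sub>F M in at_top. linked (boundary_sets M) I (snd (tile_graph I A)))}"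

lemma case_level_less: "(case u of (i, j, k) \<Rightarrow> i + j + k < l) \<longleftrightarrow> level u < l"
  by (cases u) simp

text \<open>The condition on far away rhombi amounts to finiteness of the set of long diagonals, because
only finitely many points of the octant lie above a given level.\<close>

lemma groves_eq:
  assumes I: "I \<subseteq> octant"
  shows "groves I = tile_graph I ` grove_tiles I"
proof (intro equalityI subsetI)
  fix G assume "G \<in> groves I"
  hence G: "grove I G" by (simp add: groves_def)
  define A where "A = {(q, v) \<in> tiles I. long_diag q v \<in> snd G}"
  have sub: "snd G \<subseteq> (\<lambda>(q, v). long_diag q v) ` tiles I \<union> (\<lambda>(q, v). short_diag q v) ` tiles I"
    using G by (force simp: grove_def Gamma_graph_def tiles_def)
  have excl: "(long_diag q v \<in> snd G) \<noteq> (short_diag q v \<in> snd G)" if "(q, v) \<in> tiles I" for q v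
    using G that by (auto simp: grove_def tiles_def)
  have "snd G = snd (tile_graph I A)"
  proof (intro equalityI subsetI)
    fix e assume "e \<in> snd G"
    thus "e \<in> snd (tile_graph I A)"
      using sub excl by (fastforce simp: A_def)
  next
    fix e assume "e \<in> snd (tile_graph I A)"
    thus "e \<in> snd G" using excl by (auto simp: A_def tile_graph_def)
  qed
  hence eq: "G = tile_graph I A"
    using G by (auto simp: grove_def tile_graph_def prod_eq_iff)
  have "\<exists>M::int. \<forall>q v. rhombus q v \<subseteq> I \<and> (\<forall>u \<in> rhombus q v. level u < - M) \<longrightarrow> short_diag q v \<in> snd G"
    using G unfolding grove_def case_level_less by blast
  then obtain M :: int where M: "\<And>q v. (q, v) \<in> tiles I \<Longrightarrow>
      (\<forall>u \<in> rhombus q v. level u < - M) \<Longrightarrow> short_diag q v \<in> snd G"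
    unfolding tiles_def by blast
  have "A \<subseteq> UNIV \<times> {v \<in> octant. level v \<ge> - M}"
  proof
    fix a assume "a \<in> A"
    then obtain q v where a: "a = (q, v)" "(q, v) \<in> tiles I" "long_diag q v \<in> snd G"
      by (auto simp: A_def)
    have "v \<in> octant" using I a(2) top_in_rhombus unfolding tiles_def by blast
    moreover have "\<exists>u \<in> rhombus q v. level u \<ge> - M"
      using M [of q v] excl [of q v] a by (auto simp: not_le [symmetric])
    hence "level v \<ge> - M" using rhombus_level order_trans by blast
    ultimately show "a \<in> UNIV \<times> {v \<in> octant. level v \<ge> - M}" by (simp add: a(1))
  qed
  hence "finite A"
    by (rule finite_subset) (simp add: UNIV_dir finite_octant_above)
  moreover have "\<forall>\<^sub>F M in at_top. linked (boundary_sets M) I (snd (tile_graph I A))"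
    using G unfolding eq grove_def tile_graph_def components_linked by simp
  ultimately have "A \<in> grove_tiles I" by (auto simp: grove_tiles_def A_def)
  thus "G \<in> tile_graph I ` grove_tiles I" using eq by blast
next
  fix G assume "G \<in> tile_graph I ` grove_tiles I"
  then obtain A where G: "G = tile_graph I A" and A: "A \<subseteq> tiles I" "finite A"
    "\<forall>\<^sub>F M in at_top. linked (boundary_sets M) I (snd (tile_graph I A))"
    by (auto simp: grove_tiles_def)
  obtain M :: int where M: "\<forall>a\<in>A. - level (snd a) \<le> M"
    using A(2) by (metis finite_imageI bdd_above.E bdd_above_finite image_eqI)
  have "short_diag q v \<in> snd G" if "rhombus q v \<subseteq> I" "\<forall>u\<in>rhombus q v. level u < - M" for q v
  proof -
    have "(q, v) \<notin> A" using M that(2) top_in_rhombus by fastforce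
    thus ?thesis using that by (simp add: G tiles_def)
  qed
  moreover have "snd G \<subseteq> snd (Gamma_graph I)"
    using A(1) by (auto simp: G tile_graph_def Gamma_graph_def tiles_def)
  moreover have "(long_diag q v \<in> snd G) \<noteq> (short_diag q v \<in> snd G)" if "rhombus q v \<subseteq> I" for q v
    using that by (auto simp: G tiles_def)
  moreover have "\<forall>\<^sub>F M in at_top. (\<forall>K\<in>components G. \<exists>!S. S \<in> boundary_sets M \<and> S \<subseteq> K) \<and>
      (\<forall>S\<in>boundary_sets M. \<exists>K\<in>components G. S \<subseteq> K)"
    using A(3) unfolding G tile_graph_def components_linked by simp
  moreover have "fst G = I" by (simp add: G tile_graph_def)
  ultimately have "grove I G"
    unfolding grove_def case_level_less by blast
  thus "G \<in> groves I" by (simp add: groves_def)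
qed

lemma inj_tile_graph: "inj (tile_graph I)"
proof (rule injI)
  fix A B assume "tile_graph I A = tile_graph I B"
  thus "A = B" by (metis long_diag_in_tile_graph subrelI subset_antisym)
qed

lemma boundary_sets_level: "S \<in> boundary_sets M \<Longrightarrow> s \<in> S \<Longrightarrow> level s \<le> - M - 1"
  by (auto simp: boundary_sets_def)

lemma boundary_sets_nonempty: "{} \<notin> boundary_sets M"
  by (auto simp: boundary_sets_def)

section \<open>The star-triangle move on graphs\<close>

lemma joined_refl [simp]: "(a, a) \<in> joined E"
  by (simp add: joined_def)

lemma joined_edge: "{a, b} \<in> E \<Longrightarrow> (a, b) \<in> joined E"
  by (auto simp: joined_def)

lemma joined_trans: "(a, b) \<in> joined E \<Longrightarrow> (b, c) \<in> joined E \<Longrightarrow> (a, c) \<in> joined E"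
  unfolding joined_def by (rule rtrancl_trans)

lemma joined_sym: "(a, b) \<in> joined E \<Longrightarrow> (b, a) \<in> joined E"
proof -
  have "sym {(a, b). {a, b} \<in> E}" by (auto simp: sym_def insert_commute)
  hence "sym (joined E)" unfolding joined_def by (rule sym_rtrancl)
  thus "(a, b) \<in> joined E \<Longrightarrow> (b, a) \<in> joined E" by (rule symD)
qed

lemma joined_map:
  assumes "(a, b) \<in> joined E" and "\<And>a b. {a, b} \<in> E \<Longrightarrow> (f a, f b) \<in> joined F"
  shows "(f a, f b) \<in> joined F"
  using assms(1) unfolding joined_def
proof (induction rule: rtrancl_induct)
  case (step b c)
  thus ?case using assms(2) joined_trans unfolding joined_def by fast
qed simp

text \<open>The edges on one side of a cube. The directions in \<open>T\<close> are those with a long diagonal, which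
is the side of the triangle \<open>x\<close> opposite to \<open>x q\<close>; the other directions contribute the edges from the
centre \<open>c\<close> to \<open>y q\<close>. On the opposite side of the cube, \<open>x\<close> and \<open>y\<close> are exchanged.\<close>

definition star_triangle :: "'a \<Rightarrow> (dir \<Rightarrow> 'a) \<Rightarrow> (dir \<Rightarrow> 'a) \<Rightarrow> dir set \<Rightarrow> 'a set set" where
  "star_triangle c x y T = (\<lambda>q. x ` (- {q})) ` T \<union> (\<lambda>q. {c, y q}) ` (- T)"

text \<open>The pairs of configurations on the two sides of a cube that connect the six outer vertices
in the same way.\<close>

definition matched :: "dir set \<Rightarrow> dir set \<Rightarrow> bool" where
  "matched T T' \<longleftrightarrow> (\<exists>q. T = - {q} \<and> T' = {} \<or> T = {q} \<and> T' = {q} \<or> T = {} \<and> T' = - {q})"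

lemma matched_sym: "matched T T' \<Longrightarrow> matched T' T"
  by (auto simp: matched_def)

lemma third_dir: "\<exists>t :: dir. t \<noteq> r \<and> t \<noteq> s"
  by (cases r; cases s) auto

lemma matched_obtains:
  assumes "matched T T'" obtains q where "q \<notin> T"
  using assms third_dir by (auto simp: matched_def)

text \<open>A walk is carried to the other side of the cube after the old centre has been replaced by one
of its neighbours. It suffices to see this for single edges. A side of the triangle \<open>x\<close> in direction
\<open>q\<close> in \<open>T\<close> is replaced by two edges of the new star, since \<open>T'\<close> contains no other direction than
\<open>q\<close>. Two edges of the old star are replaced by a path in the new triangle.\<close>

lemma star_triangle_joined:
  assumes T: "matched T T'" and p: "p \<notin> T"
    and c: "c \<notin> \<Union>E" "c \<notin> range x" "c \<notin> range y"
    and ab: "(a, b) \<in> joined (E \<union> star_triangle c x y T)"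
  defines "\<phi> \<equiv> \<lambda>z. if z = c then y p else z"
  shows "(\<phi> a, \<phi> b) \<in> joined (E \<union> star_triangle c' y x T')"
  using ab
proof (rule joined_map)
  define J where "J = joined (E \<union> star_triangle c' y x T')"
  note trans = joined_trans [of _ _ "E \<union> star_triangle c' y x T'", folded J_def]
  note sym = joined_sym [of _ _ "E \<union> star_triangle c' y x T'", folded J_def]
  have star: "(x r, x s) \<in> J" if "r \<notin> T'" "s \<notin> T'" for r s
  proof -
    have "(c', x t) \<in> J" if "t \<notin> T'" for t
      unfolding J_def by (rule joined_edge) (use that in \<open>auto simp: star_triangle_def\<close>)
    thus ?thesis using that trans sym by blast
  qed
  have triangle: "(y r, y s) \<in> J" if "t \<in> T'" "r \<noteq> t" "s \<noteq> t" for r s t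
  proof (cases "r = s")
    case False
    hence "z = r \<or> z = s \<or> z = t" for z
      using that by (cases r; cases s; cases t; cases z) auto
    hence "- {t} = {r, s}" using that by auto
    hence "{y r, y s} = y ` (- {t})" by simp
    thus ?thesis unfolding J_def by (intro joined_edge) (use that(1) in \<open>auto simp: star_triangle_def\<close>)
  qed (simp add: J_def)
  have fan: "(y r, y s) \<in> J" if rs: "r \<notin> T" "s \<notin> T" for r s
  proof (cases "T = {}")
    case True
    then obtain q where T': "T' = - {q}"
      using T third_dir unfolding matched_def True by blast
    have "(y t, y q) \<in> J" for t
    proof (cases "t = q")
      case False
      obtain u where "u \<noteq> t" "u \<noteq> q" using third_dir by blast
      thus ?thesis by (intro triangle [of u]) (auto simp: T')
    qed (simp add: J_def)
    thus ?thesis using trans sym by blast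
  next
    case False
    show ?thesis
    proof (cases "r = s")
      case False
      then obtain t where "T = {t}" "T' = {t}"
        using T rs \<open>T \<noteq> {}\<close> unfolding matched_def by blast
      thus ?thesis using rs by (intro triangle [of t]) auto
    qed (simp add: J_def)
  qed
  fix a b assume "{a, b} \<in> E \<union> star_triangle c x y T"
  then consider (old) "{a, b} \<in> E" | (triangle) q where "q \<in> T" "{a, b} = x ` (- {q})"
    | (star) q where "q \<notin> T" "{a, b} = {c, y q}"
    by (auto simp: star_triangle_def)
  hence "(\<phi> a, \<phi> b) \<in> J"
  proof cases
    case old
    hence "\<phi> a = a" "\<phi> b = b" using c(1) by (auto simp: \<phi>_def)
    thus ?thesis unfolding J_def by (intro joined_edge) (use old in auto)
  next
    case (triangle q)
    have "a \<in> x ` (- {q})" "b \<in> x ` (- {q})" using triangle(2) by auto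
    then obtain r s where rs: "a = x r" "b = x s" "r \<noteq> q" "s \<noteq> q" by auto
    moreover from this have "r \<notin> T'" "s \<notin> T'" using T triangle(1) by (auto simp: matched_def)
    moreover have "\<phi> a = a" "\<phi> b = b" using rs c(2) by (auto simp: \<phi>_def)
    ultimately show ?thesis using star by simp
  next
    case (star q)
    have "y q \<noteq> c" using c(3) by auto
    thus ?thesis using star fan [OF p, of q] fan [OF _ p, of q]
      by (auto simp: \<phi>_def doubleton_eq_iff)
  qed
  thus "(\<phi> a, \<phi> b) \<in> joined (E \<union> star_triangle c' y x T')" unfolding J_def .
qed

text \<open>The maps that replace a centre by a neighbour identify the components on both sides. They
fix the boundary vertices, which avoid the cube.\<close>

lemma linked_star_triangle:
  assumes T: "matched T T'"
    and V: "c \<in> V" "c' \<notin> V" "V' = insert c' (V - {c})"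
    and E: "\<Union>E \<subseteq> V - {c}" "range x \<subseteq> V - {c}" "range y \<subseteq> V - {c}"
    and B: "c \<notin> \<Union>B" "c' \<notin> \<Union>B"
    and linked: "linked B V (E \<union> star_triangle c x y T)"
  shows "linked B V' (E \<union> star_triangle c' y x T')"
proof -
  define J where "J = joined (E \<union> star_triangle c x y T)"
  define J' where "J' = joined (E \<union> star_triangle c' y x T')"
  obtain p where p: "p \<notin> T" using T by (rule matched_obtains)
  obtain p' where p': "p' \<notin> T'" using matched_sym [OF T] by (rule matched_obtains)
  \<comment> \<open>Maps between the two vertex sets. They are inverse to each other up to joined vertices.\<close>
  define \<phi> where "\<phi> = (\<lambda>z. if z = c then y p else z)"
  define \<psi> where "\<psi> = (\<lambda>z. if z = c' then x p' else z)"
  have avoid: "c \<notin> \<Union>E" "c \<notin> range x" "c \<notin> range y"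
    using E by auto
  have avoid': "c' \<notin> \<Union>E" "c' \<notin> range y" "c' \<notin> range x"
    using E V(2) by auto
  have \<phi>: "(\<phi> a, \<phi> b) \<in> J'" if "(a, b) \<in> J" for a b
    unfolding J'_def \<phi>_def
    using star_triangle_joined [OF T p avoid that [unfolded J_def]] .
  have \<psi>: "(\<psi> a, \<psi> b) \<in> J" if "(a, b) \<in> J'" for a b
    unfolding J_def \<psi>_def
    using star_triangle_joined [OF matched_sym [OF T] p' avoid' that [unfolded J'_def]] .
  have c': "(c', x p') \<in> J'"
    unfolding J'_def by (rule joined_edge) (use p' in \<open>auto simp: star_triangle_def\<close>)
  have range: "x q \<in> V \<and> x q \<noteq> c" "y q \<in> V \<and> y q \<noteq> c" for q
    using E(2,3) by (auto simp: image_subset_iff)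
  have \<psi>_V: "\<psi> u \<in> V" if "u \<in> V'" for u
    using that V range by (auto simp: \<psi>_def)
  have \<phi>_V: "\<phi> u \<in> V'" if "u \<in> V" for u
    using that V range by (auto simp: \<phi>_def)
  have iff: "s \<in> V' \<and> (u, s) \<in> J' \<longleftrightarrow> s \<in> V \<and> (\<psi> u, s) \<in> J" if "u \<in> V'" "s \<in> S" "S \<in> B" for u s S
  proof -
    have s: "s \<noteq> c" "s \<noteq> c'" using B that by auto
    have there_and_back: "(u, \<phi> (\<psi> u)) \<in> J'"
      using c' range that(1) V by (auto simp: \<phi>_def \<psi>_def J'_def)
    have "(\<psi> u, s) \<in> J" if "(u, s) \<in> J'"
      using \<psi> [OF that] s by (simp add: \<psi>_def)
    moreover have "(u, s) \<in> J'" if "(\<psi> u, s) \<in> J"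
      using \<phi> [OF that] there_and_back s joined_trans unfolding J'_def by (force simp: \<phi>_def)
    ultimately show ?thesis using V s by auto
  qed
  have lnk: "\<And>u. u \<in> V \<Longrightarrow> \<exists>!S. S \<in> B \<and> (\<forall>s\<in>S. s \<in> V \<and> (u, s) \<in> J)"
    "\<And>S. S \<in> B \<Longrightarrow> \<exists>u\<in>V. \<forall>s\<in>S. s \<in> V \<and> (u, s) \<in> J"
    using linked unfolding linked_def J_def by simp_all
  have 1: "\<exists>!S. S \<in> B \<and> (\<forall>s\<in>S. s \<in> V' \<and> (u, s) \<in> J')" if u: "u \<in> V'" for u
  proof -
    have "(S \<in> B \<and> (\<forall>s\<in>S. s \<in> V' \<and> (u, s) \<in> J')) \<longleftrightarrow> (S \<in> B \<and> (\<forall>s\<in>S. s \<in> V \<and> (\<psi> u, s) \<in> J))" for S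
      by (rule conj_cong [OF refl], rule ball_cong [OF refl], rule iff [OF u])
    thus ?thesis using lnk(1) [OF \<psi>_V [OF u]] by simp
  qed
  have 2: "\<exists>u\<in>V'. \<forall>s\<in>S. s \<in> V' \<and> (u, s) \<in> J'" if S: "S \<in> B" for S
  proof -
    obtain u where u: "u \<in> V" "\<And>s. s \<in> S \<Longrightarrow> s \<in> V \<and> (u, s) \<in> J" using lnk(2) [OF S] by blast
    have "s \<in> V' \<and> (\<phi> u, s) \<in> J'" if "s \<in> S" for s
    proof -
      have "s \<noteq> c" using B S that by auto
      thus ?thesis using \<phi> [of u s] u(2) [OF that] V by (auto simp: \<phi>_def)
    qed
    thus ?thesis using \<phi>_V u(1) by blast
  qed
  show ?thesis unfolding linked_def J'_def [symmetric] by (intro conjI ballI 1 2)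
qed

text \<open>A component that consists of a vertex outside of all the prescribed sets contains none of
them. This excludes three long diagonals on one side of a cube.\<close>

lemma linked_not_isolated:
  assumes "c \<in> V" "c \<notin> \<Union>E" "c \<notin> \<Union>B" "{} \<notin> B"
  shows "\<not> linked B V E"
proof
  assume "linked B V E"
  then obtain S where S: "S \<in> B" "\<forall>s\<in>S. (c, s) \<in> joined E"
    using assms(1) by (auto simp: linked_def)
  obtain s where s: "s \<in> S" using S(1) assms(4) by (cases "S = {}") auto
  have "s = c" if "(c, s) \<in> joined E"
    using that assms(2) unfolding joined_def by (induction rule: rtrancl_induct) auto
  thus False using S s assms(3) by auto
qed

section \<open>The only grove on the boundary of the octant\<close>

primrec diag :: "dir \<Rightarrow> point" where
  "diag Da = (0, 1, 1)"
| "diag Db = (1, 0, 1)"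
| "diag Dc = (1, 1, 0)"

lemma level_diag [simp]: "level (diag q) = 2"
  by (cases q) auto

lemma short_diag_alt: "short_diag q v = {v, v - diag q}"
  by (cases q; cases v) auto

lemma long_diag_level: "u \<in> long_diag q v \<Longrightarrow> level u = level v - 1"
  by (cases q; cases v) auto

lemma region_boundary_octant:
  "(i, j, k) \<in> region_boundary octant \<longleftrightarrow> i \<le> 0 \<and> j \<le> 0 \<and> k \<le> 0 \<and> (i = 0 \<or> j = 0 \<or> k = 0)"
  by (auto simp: region_boundary_def octant_iff)

text \<open>The relative interior of a face of the octant, in which rhombi of a single type occur.\<close>

primrec face :: "dir \<Rightarrow> point \<Rightarrow> bool" where
  "face Da = (\<lambda>(i, j, k). i = 0 \<and> j < 0 \<and> k < 0)"
| "face Db = (\<lambda>(i, j, k). j = 0 \<and> i < 0 \<and> k < 0)"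
| "face Dc = (\<lambda>(i, j, k). k = 0 \<and> i < 0 \<and> j < 0)"

text \<open>The short diagonals in a face follow the lines on which this difference of the two free
coordinates is constant.\<close>

primrec line :: "dir \<Rightarrow> point \<Rightarrow> int" where
  "line Da = (\<lambda>(i, j, k). j - k)"
| "line Db = (\<lambda>(i, j, k). i - k)"
| "line Dc = (\<lambda>(i, j, k). i - j)"

lemma tiles_octant:
  "(q, v) \<in> tiles (region_boundary octant) \<longleftrightarrow> v \<in> octant \<and> face q (v - diag q)"
proof
  assume "(q, v) \<in> tiles (region_boundary octant)"
  hence "v \<in> region_boundary octant" "v - diag q \<in> region_boundary octant"
    using top_in_rhombus [of v q] short_diag_subset_rhombus [of q v]
    unfolding tiles_def short_diag_alt by blast+
  thus "v \<in> octant \<and> face q (v - diag q)"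
    by (cases q; cases v) (auto simp: region_boundary_octant octant_iff)
next
  assume "v \<in> octant \<and> face q (v - diag q)"
  thus "(q, v) \<in> tiles (region_boundary octant)"
    by (cases q; cases v) (simp_all add: tiles_def region_boundary_octant octant_iff)
qed

lemma face_tile_down: "face q p \<Longrightarrow> (r, p) \<in> tiles (region_boundary octant) \<Longrightarrow> r = q"
  by (cases q; cases r; cases p) (simp_all add: tiles_octant octant_iff)

lemma face_tile_up: "face q p \<Longrightarrow> (r, p + diag r) \<in> tiles (region_boundary octant) \<Longrightarrow> r = q"
  by (cases q; cases r; cases p) (simp_all add: tiles_octant octant_iff)

lemma boundary_sets_iff:
  "S \<in> boundary_sets M \<longleftrightarrow>
     (\<exists>p q. 0 > p \<and> p > q \<and> p + q \<in> {- M - 1, - M - 2} \<and>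
        (S = {(0, p, q), (p, 0, q)} \<or> S = {(p, q, 0), (0, q, p)} \<or> S = {(q, 0, p), (q, p, 0)})) \<or>
     (\<exists>p. 2 * p \<in> {- M - 1, - M - 2} \<and> S = {(0, p, p), (p, 0, p), (p, p, 0)}) \<or>
     (\<exists>q \<le> - M - 1. S = {(0, 0, q)} \<or> S = {(0, q, 0)} \<or> S = {(q, 0, 0)})"
  unfolding boundary_sets_def Un_iff mem_Collect_eq by iprover

lemma boundary_sets_pair:
  assumes "0 > p" "p > q" "p + q \<in> {- M - 1, - M - 2}"
  shows "{(0, p, q), (p, 0, q)} \<in> boundary_sets M" "{(p, q, 0), (0, q, p)} \<in> boundary_sets M"
    "{(q, 0, p), (q, p, 0)} \<in> boundary_sets M"
  unfolding boundary_sets_iff using assms by (intro disjI1 exI [of _ p] exI [of _ q]; simp)+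

lemma boundary_sets_triple:
  assumes "2 * p \<in> {- M - 1, - M - 2}"
  shows "{(0, p, p), (p, 0, p), (p, p, 0)} \<in> boundary_sets M"
  unfolding boundary_sets_iff using assms by (intro disjI1 disjI2 exI [of _ p]) simp

lemma boundary_sets_subset:
  assumes "M \<ge> 0" "S \<in> boundary_sets M"
  shows "S \<subseteq> region_boundary octant"
proof -
  have neg: "p < 0" if "2 * p \<in> {- M - 1, - M - 2}" for p :: int
    using that assms(1) by auto
  show ?thesis
    using assms(2) unfolding boundary_sets_iff
    by (elim disjE exE conjE)
      (use assms(1) in \<open>auto simp del: insert_iff simp: region_boundary_octant insert_subset dest!: neg\<close>)
qed

text \<open>So a component that contains a prescribed set cannot stay inside a face.\<close>

lemma face_boundary_set:
  assumes "face q p" "level p = - M - 1"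
  shows "\<exists>S \<in> boundary_sets M. p \<in> S \<and> (\<exists>s\<in>S. \<not> face q s)"
proof (cases p)
  case (fields i j k)
  have pair: "{(0, b, c), (b, 0, c)} \<in> boundary_sets M" "{(b, c, 0), (0, c, b)} \<in> boundary_sets M"
    "{(c, 0, b), (c, b, 0)} \<in> boundary_sets M"
    if "0 > b" "b > c" "b + c = - M - 1" for b c
    using boundary_sets_pair [of b c M] that by simp_all
  have triple: "{(0, b, b), (b, 0, b), (b, b, 0)} \<in> boundary_sets M" if "2 * b = - M - 1" for b
    using boundary_sets_triple [of b M] that by simp
  have *: "\<exists>S \<in> boundary_sets M. p \<in> S \<and> (\<exists>s\<in>S. \<not> face q s)"
    if "S \<in> boundary_sets M" "p \<in> S" "s \<in> S" "\<not> face q s" for S s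
    using that by blast
  show ?thesis
  proof (cases q)
    case Da
    have p: "i = 0" "j < 0" "k < 0" "j + k = - M - 1" using assms by (auto simp: fields Da)
    consider "j > k" | "j < k" | "j = k" by linarith
    thus ?thesis
    proof cases
      case 1 thus ?thesis using pair(1) [of j k] p by (intro * [of _ "(j, 0, k)"]) (auto simp: fields Da)
    next
      case 2 thus ?thesis using pair(2) [of k j] p by (intro * [of _ "(k, j, 0)"]) (auto simp: fields Da)
    next
      case 3 thus ?thesis using triple [of j] p by (intro * [of _ "(j, 0, j)"]) (auto simp: fields Da)
    qed
  next
    case Db
    have p: "j = 0" "i < 0" "k < 0" "i + k = - M - 1" using assms by (auto simp: fields Db)
    consider "i > k" | "i < k" | "i = k" by linarith
    thus ?thesis
    proof cases
      case 1 thus ?thesis using pair(1) [of i k] p by (intro * [of _ "(0, i, k)"]) (auto simp: fields Db)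
    next
      case 2 thus ?thesis using pair(3) [of k i] p by (intro * [of _ "(i, k, 0)"]) (auto simp: fields Db)
    next
      case 3 thus ?thesis using triple [of i] p by (intro * [of _ "(0, i, i)"]) (auto simp: fields Db)
    qed
  next
    case Dc
    have p: "k = 0" "i < 0" "j < 0" "i + j = - M - 1" using assms by (auto simp: fields Dc)
    consider "i > j" | "i < j" | "i = j" by linarith
    thus ?thesis
    proof cases
      case 1 thus ?thesis using pair(2) [of i j] p by (intro * [of _ "(0, j, i)"]) (auto simp: fields Dc)
    next
      case 2 thus ?thesis using pair(3) [of j i] p by (intro * [of _ "(i, 0, j)"]) (auto simp: fields Dc)
    next
      case 3 thus ?thesis using triple [of i] p by (intro * [of _ "(0, i, i)"]) (auto simp: fields Dc)
    qed
  qed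
qed

lemma face_ray_far:
  assumes "face q p"
  shows "\<exists>p'. face q p' \<and> line q p' = line q p \<and> level p' \<le> min l (level p)"
proof -
  define n where "n = \<bar>l\<bar>"
  obtain i j k where p: "p = (i, j, k)" by (cases p)
  define p' where "p' = (case q of Da \<Rightarrow> (i, j - n, k - n) | Db \<Rightarrow> (i - n, j, k - n) | Dc \<Rightarrow> (i - n, j - n, k))"
  have "face q p' \<and> line q p' = line q p \<and> level p' \<le> min l (level p)"
    using assms by (cases q) (auto simp: p'_def n_def p)
  thus ?thesis by blast
qed

text \<open>A point on the line of \<open>v\<close>, strictly below \<open>v\<close>, lies at an even distance from it. So one step
upwards cannot pass \<open>v\<close>, it can only reach \<open>v\<close>.\<close>

lemma face_line_step:
  assumes "face q p" "line q p = line q v" "level p \<le> level v - 2" "face q (v - diag q)" "v \<noteq> p + diag q"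
  shows "face q (p + diag q) \<and> line q (p + diag q) = line q v \<and> level (p + diag q) \<le> level v - 2"
proof -
  obtain i j k where p: "p = (i, j, k)" by (cases p)
  obtain a b c where v: "v = (a, b, c)" by (cases v)
  show ?thesis using assms by (cases q) (auto simp: p v)
qed

lemma face_line_down:
  "face q p \<Longrightarrow> face q (p - diag q) \<and> line q (p - diag q) = line q p"
  by (cases q; cases p) auto

text \<open>Suppose that a long diagonal occurs, and take one on the lowest possible level, in the rhombus
at \<open>v\<close>. All rhombi further down carry short diagonals, so the points of the line of \<open>v\<close> strictly below
\<open>v\<close> form a ray that no edge leaves. But far down, the ray meets a prescribed set that has to be
connected to a point in a different face.\<close>

lemma grove_tiles_octant_empty:
  assumes A: "A \<in> grove_tiles (region_boundary octant)"
  shows "A = {}"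
proof (rule ccontr)
  assume "A \<noteq> {}"
  define I where "I = region_boundary octant"
  have fin: "finite A" and sub: "A \<subseteq> tiles I"
    and ev: "\<forall>\<^sub>F M in at_top. linked (boundary_sets M) I (snd (tile_graph I A))"
    using A by (auto simp: grove_tiles_def I_def)
  define m where "m = Min ((\<lambda>a. level (snd a)) ` A)"
  have "m \<in> (\<lambda>a. level (snd a)) ` A"
    unfolding m_def using fin \<open>A \<noteq> {}\<close> by (intro Min_in) auto
  then obtain q v where qv: "(q, v) \<in> A" "level v = m" by auto
  have least: "level v \<le> level u" if "(r, u) \<in> A" for r u
    unfolding qv(2) m_def using fin that by (intro Min_le) force+
  have face_v: "face q (v - diag q)" using qv(1) sub by (auto simp: I_def tiles_octant)
  define R where "R = {p. face q p \<and> line q p = line q v \<and> level p \<le> level v - 2}"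
  have closed: "p' \<in> R" if p: "p \<in> R" and e: "{p, p'} \<in> snd (tile_graph I A)" for p p'
  proof -
    consider r u where "(r, u) \<in> A" "{p, p'} = long_diag r u"
      | r u where "(r, u) \<in> tiles I - A" "{p, p'} = short_diag r u"
      using e by (auto simp: tile_graph_def)
    thus ?thesis
    proof cases
      case (1 r u)
      hence "level p = level u - 1" by (intro long_diag_level) auto
      thus ?thesis using p least [OF 1(1)] by (simp add: R_def)
    next
      case (2 r u)
      hence "p = u \<and> p' = u - diag r \<or> p' = u \<and> p = u - diag r"
        by (auto simp: short_diag_alt doubleton_eq_iff)
      thus ?thesis
      proof
        assume *: "p = u \<and> p' = u - diag r"
        hence "r = q" using 2(1) p face_tile_down [of q p r] by (auto simp: R_def I_def)
        thus ?thesis using p * face_line_down [of q p] by (auto simp: R_def)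
      next
        assume *: "p' = u \<and> p = u - diag r"
        hence u: "u = p + diag r" by simp
        hence r: "r = q" using 2(1) p face_tile_up [of q p r] by (auto simp: R_def I_def)
        hence "v \<noteq> p + diag q" using 2(1) qv(1) u by blast
        moreover have "p' = p + diag q" using * u r by simp
        ultimately show ?thesis
          using p face_line_step [of q p v, OF _ _ _ face_v] unfolding R_def by blast
      qed
    qed
  qed
  have reach: "p' \<in> R" if "p \<in> R" "(p, p') \<in> joined (snd (tile_graph I A))" for p p'
    using that(2,1) unfolding joined_def by (induction rule: rtrancl_induct) (use closed in auto)
  obtain M0 where M0: "\<And>M. M \<ge> M0 \<Longrightarrow> linked (boundary_sets M) I (snd (tile_graph I A))"
    using ev by (auto simp: eventually_at_top_linorder)
  obtain p where p: "face q p" "line q p = line q (v - diag q)"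
      "level p \<le> min (- M0 - 1) (level (v - diag q))"
    using face_ray_far [OF face_v] by blast
  have "line q (v - diag q) = line q v" by (cases q; cases v) auto
  hence pR: "p \<in> R" using p by (simp add: R_def)
  \<comment> \<open>With this bound, \<open>p\<close> lies on one of the two levels of the prescribed pairs and triples.\<close>
  define M where "M = - level p - 1"
  have M: "M \<ge> M0" using p(3) by (simp add: M_def)
  obtain S s where S: "S \<in> boundary_sets M" "p \<in> S" "s \<in> S" "\<not> face q s"
    using face_boundary_set [OF p(1), of M] by (auto simp: M_def)
  obtain u where "(u, p) \<in> joined (snd (tile_graph I A))" "(u, s) \<in> joined (snd (tile_graph I A))"
    using M0 [OF M] S unfolding linked_def by blast
  hence "(p, s) \<in> joined (snd (tile_graph I A))"
    by (rule joined_trans [OF joined_sym])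
  hence "s \<in> R" by (rule reach [OF pR])
  thus False using S(4) by (simp add: R_def)
qed

text \<open>The end point on a coordinate axis of the path of short diagonals through a point of the
boundary of the octant.\<close>

definition axis_root :: "point \<Rightarrow> point" where
  "axis_root = (\<lambda>(i, j, k). if i \<le> j \<and> i \<le> k then (i - j - k, 0, 0)
     else if j \<le> i \<and> j \<le> k then (0, j - i - k, 0) else (0, 0, k - i - j))"

lemma axis_root_diag: "(q, v) \<in> tiles (region_boundary octant) \<Longrightarrow> axis_root (v - diag q) = axis_root v"
  by (cases q; cases v) (auto simp: tiles_octant octant_iff axis_root_def)

lemma joined_axis_root:
  assumes "v \<in> region_boundary octant"
  shows "(v, axis_root v) \<in> joined (snd (tile_graph (region_boundary octant) {}))"
  using assms
proof (induction "nat (- level v)" arbitrary: v rule: less_induct)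
  case less
  obtain i j k where v: "v = (i, j, k)" by (cases v)
  show ?case
  proof (cases "\<exists>q. face q v")
    case True
    then obtain q where q: "face q v" by blast
    have u: "(q, v + diag q) \<in> tiles (region_boundary octant)" "level v < -1" "v + diag q \<in> region_boundary octant"
      using q by (cases q; auto simp: tiles_octant v octant_iff region_boundary_octant)+
    have "short_diag q (v + diag q) \<in> snd (tile_graph (region_boundary octant) {})"
      using u by simp
    hence "(v, v + diag q) \<in> joined (snd (tile_graph (region_boundary octant) {}))"
      by (intro joined_edge) (simp add: short_diag_alt insert_commute)
    moreover have "(v + diag q, axis_root (v + diag q)) \<in> joined (snd (tile_graph (region_boundary octant) {}))"
      using u by (intro less.hyps) auto
    moreover have "axis_root (v + diag q) = axis_root v"
      using axis_root_diag [OF u(1)] by simp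
    ultimately show ?thesis using joined_trans by metis
  next
    case False
    hence "\<not> face Da v" "\<not> face Db v" "\<not> face Dc v" by blast+
    moreover have "i \<le> 0" "j \<le> 0" "k \<le> 0" "i = 0 \<or> j = 0 \<or> k = 0"
      using less.prems by (simp_all add: v region_boundary_octant)
    ultimately have "i = 0 \<and> j = 0 \<or> i = 0 \<and> k = 0 \<or> j = 0 \<and> k = 0"
      unfolding v face.simps prod.case by linarith
    hence "axis_root v = v"
      using \<open>i \<le> 0\<close> \<open>j \<le> 0\<close> \<open>k \<le> 0\<close> by (elim disjE) (simp_all add: v axis_root_def)
    thus ?thesis by simp
  qed
qed

lemma joined_iff_axis_root:
  assumes "u \<in> region_boundary octant" "s \<in> region_boundary octant"
  shows "(u, s) \<in> joined (snd (tile_graph (region_boundary octant) {})) \<longleftrightarrow> axis_root u = axis_root s"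
proof
  assume "(u, s) \<in> joined (snd (tile_graph (region_boundary octant) {}))"
  thus "axis_root u = axis_root s" unfolding joined_def
  proof (induction rule: rtrancl_induct)
    case (step y z)
    then obtain q v where "(q, v) \<in> tiles (region_boundary octant)" "{y, z} = {v, v - diag q}"
      by (auto simp: tile_graph_def short_diag_alt)
    thus ?case using step.IH axis_root_diag [of q v] by (auto simp: doubleton_eq_iff)
  qed simp
next
  assume "axis_root u = axis_root s"
  thus "(u, s) \<in> joined (snd (tile_graph (region_boundary octant) {}))"
    using joined_axis_root [OF assms(1)] joined_sym [OF joined_axis_root [OF assms(2)]]
    by (auto intro: joined_trans)
qed

text \<open>The prescribed set that belongs to the component of a point on an axis at distance \<open>d\<close> from
the origin. Far out, it is the point itself. Otherwise it consists of the points of the component on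
the one of the levels \<open>- M - 1\<close> and \<open>- M - 2\<close> that has the parity of \<open>d\<close>, as every short diagonal
changes the level by 2. The rounded division selects this level.\<close>

definition level_set :: "int \<Rightarrow> point \<Rightarrow> point set" where
  "level_set M = (\<lambda>(i, j, k). let d = - (i + j + k); p = - ((M + 2 - d) div 2) in
     if d \<ge> M + 1 then {(i, j, k)}
     else if d = 0 then {(0, p, p), (p, 0, p), (p, p, 0)}
     else if i < 0 then {(p - d, 0, p), (p - d, p, 0)}
     else if j < 0 then {(p, p - d, 0), (0, p - d, p)}
     else {(0, p, p - d), (p, 0, p - d)})"

lemma boundary_set_eq_level_set:
  assumes "M \<ge> 0" "S \<in> boundary_sets M" "s \<in> S"
  shows "S = level_set M (axis_root s)"
proof -
  have div: "(M + 2 - (p - q)) div 2 = - p" if "p + q \<in> {- M - 1, - M - 2}" for p q :: int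
    using that by auto
  have div0: "(M + 2) div 2 = - p" if "2 * p \<in> {- M - 1, - M - 2}" for p :: int
    using that by auto
  consider (c) p q where "0 > p" "p > q" "p + q \<in> {- M - 1, - M - 2}" "S = {(0, p, q), (p, 0, q)}"
    | (b) p q where "0 > p" "p > q" "p + q \<in> {- M - 1, - M - 2}" "S = {(p, q, 0), (0, q, p)}"
    | (a) p q where "0 > p" "p > q" "p + q \<in> {- M - 1, - M - 2}" "S = {(q, 0, p), (q, p, 0)}"
    | (triple) p where "2 * p \<in> {- M - 1, - M - 2}" "S = {(0, p, p), (p, 0, p), (p, p, 0)}"
    | (far) q where "q \<le> - M - 1" "S = {(0, 0, q)} \<or> S = {(0, q, 0)} \<or> S = {(q, 0, 0)}"
    using assms(2) unfolding boundary_sets_iff by metis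
  thus ?thesis
  proof cases
    case (c p q)
    hence "axis_root s = (0, 0, q - p)" using assms(3) by (auto simp: axis_root_def)
    moreover have "p - q < M + 1" using c by auto
    ultimately show ?thesis using c div [OF c(3)] by (simp add: level_set_def Let_def algebra_simps)
  next
    case (b p q)
    hence "axis_root s = (0, q - p, 0)" using assms(3) by (auto simp: axis_root_def)
    moreover have "p - q < M + 1" using b by auto
    ultimately show ?thesis using b div [OF b(3)] by (simp add: level_set_def Let_def algebra_simps)
  next
    case (a p q)
    hence "axis_root s = (q - p, 0, 0)" using assms(3) by (auto simp: axis_root_def)
    moreover have "p - q < M + 1" using a by auto
    ultimately show ?thesis using a div [OF a(3)] by (simp add: level_set_def Let_def algebra_simps)
  next
    case (triple p)
    hence "p < 0" using assms(1) by auto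
    hence "axis_root s = (0, 0, 0)" using assms(3) triple by (auto simp: axis_root_def)
    thus ?thesis using triple div0 [OF triple(1)] assms(1) by (simp add: level_set_def Let_def)
  next
    case (far q)
    thus ?thesis using assms(1,3) by (auto simp: level_set_def axis_root_def)
  qed
qed

lemma level_set_boundary_set:
  assumes "M \<ge> 0" "axis_root v = v" "v \<in> region_boundary octant"
  shows "level_set M v \<in> boundary_sets M \<and> (\<forall>s \<in> level_set M v. axis_root s = v \<and> s \<in> region_boundary octant)"
proof -
  obtain d where d: "d \<ge> 0" "v = (- d, 0, 0) \<or> v = (0, - d, 0) \<or> v = (0, 0, - d)"
  proof -
    obtain i j k where v: "v = (i, j, k)" by (cases v)
    have "\<exists>d\<ge>0. v = (- d, 0, 0) \<or> v = (0, - d, 0) \<or> v = (0, 0, - d)"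
      using assms(2,3) by (intro exI [of _ "- i - j - k"]) (auto simp: v axis_root_def region_boundary_octant split: if_splits)
    thus ?thesis using that by blast
  qed
  show ?thesis
  proof (cases "d \<ge> M + 1")
    case True
    hence "level_set M v = {v}" using d by (auto simp: level_set_def)
    moreover have "{v} \<in> boundary_sets M"
      unfolding boundary_sets_iff using True d(2) by (intro disjI2 exI [of _ "- d"]) auto
    ultimately show ?thesis using assms by simp
  next
    case False
    define p where "p = - ((M + 2 - d) div 2)"
    have p: "p < 0" "p + (p - d) \<in> {- M - 1, - M - 2}"
      unfolding p_def using False by auto
    show ?thesis
    proof (cases "d = 0")
      case True
      have "level_set M v = {(0, p, p), (p, 0, p), (p, p, 0)}"
        using d False True by (auto simp: level_set_def p_def Let_def)
      moreover have "{(0, p, p), (p, 0, p), (p, p, 0)} \<in> boundary_sets M"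
        using p True by (intro boundary_sets_triple) simp
      ultimately show ?thesis using d p True by (auto simp: axis_root_def region_boundary_octant)
    next
      case d0: False
      have "{(0, p, p - d), (p, 0, p - d)} \<in> boundary_sets M" "{(p - d, 0, p), (p - d, p, 0)} \<in> boundary_sets M"
         "{(p, p - d, 0), (0, p - d, p)} \<in> boundary_sets M"
        using p d(1) d0 by (intro boundary_sets_pair; simp)+
      moreover have "level_set M (- d, 0, 0) = {(p - d, 0, p), (p - d, p, 0)}"
         "level_set M (0, - d, 0) = {(p, p - d, 0), (0, p - d, p)}"
         "level_set M (0, 0, - d) = {(0, p, p - d), (p, 0, p - d)}"
        using d(1) False d0 by (auto simp: level_set_def p_def Let_def)
      moreover have "d > 0" using d(1) d0 by simp
      ultimately show ?thesis
        using d(2) p(1) by (elim disjE) (simp_all add: axis_root_def region_boundary_octant)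
    qed
  qed
qed

text \<open>The components of the graph of all short diagonals are the preimages of the points on the axes
under \<open>axis_root\<close>, and each contains exactly one prescribed set.\<close>

lemma grove_tiles_octant: "grove_tiles (region_boundary octant) = {{}}"
proof -
  define I where "I = region_boundary octant"
  have root_I: "axis_root u \<in> I \<and> axis_root (axis_root u) = axis_root u" if "u \<in> I" for u
    using that by (cases u) (auto simp: I_def region_boundary_octant axis_root_def)
  have "linked (boundary_sets M) I (snd (tile_graph I {}))" if M: "M \<ge> 0" for M
    unfolding linked_def
  proof (intro conjI ballI)
    fix u assume u: "u \<in> I"
    note ls = level_set_boundary_set [OF M, of "axis_root u", folded I_def]
    show "\<exists>!S. S \<in> boundary_sets M \<and> (\<forall>s\<in>S. s \<in> I \<and> (u, s) \<in> joined (snd (tile_graph I {})))"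
    proof (rule ex1I [of _ "level_set M (axis_root u)"])
      show "level_set M (axis_root u) \<in> boundary_sets M \<and>
          (\<forall>s\<in>level_set M (axis_root u). s \<in> I \<and> (u, s) \<in> joined (snd (tile_graph I {})))"
        using ls root_I [OF u] joined_iff_axis_root [OF u [unfolded I_def], folded I_def] by simp
      fix S assume S: "S \<in> boundary_sets M \<and> (\<forall>s\<in>S. s \<in> I \<and> (u, s) \<in> joined (snd (tile_graph I {})))"
      then obtain s where s: "s \<in> S" using boundary_sets_nonempty by (cases "S = {}") auto
      hence "axis_root s = axis_root u"
        using S joined_iff_axis_root [folded I_def, of u s] u by force
      thus "S = level_set M (axis_root u)" using boundary_set_eq_level_set [OF M _ s] S by simp
    qed
  next
    fix S assume S: "S \<in> boundary_sets M"
    obtain s where s: "s \<in> S" using S boundary_sets_nonempty by (cases "S = {}") auto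
    have SI: "S \<subseteq> I" by (rule boundary_sets_subset [OF M S, folded I_def])
    hence sI: "s \<in> I" using s by blast
    have "axis_root s' = axis_root s" if "s' \<in> S" for s'
    proof -
      have "s' \<in> level_set M (axis_root s)"
        using that boundary_set_eq_level_set [OF M S s] by (rule subst [rotated])
      thus ?thesis
        using level_set_boundary_set [OF M, of "axis_root s", folded I_def] root_I [OF sI] by blast
    qed
    hence "s' \<in> I \<and> (s, s') \<in> joined (snd (tile_graph I {}))" if "s' \<in> S" for s'
      using that SI sI joined_iff_axis_root [folded I_def, of s s'] by auto
    thus "\<exists>u\<in>I. \<forall>s\<in>S. s \<in> I \<and> (u, s) \<in> joined (snd (tile_graph I {}))"
      using sI by blast
  qed
  hence "{} \<in> grove_tiles I"
    unfolding grove_tiles_def by (auto simp: eventually_at_top_linorder intro: exI [of _ 0])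
  thus ?thesis using grove_tiles_octant_empty unfolding I_def by blast
qed

section \<open>The elementary move on initial conditions\<close>

lemma lower_region_down:
  assumes "lower_region L" "v \<in> L" "u - v \<in> octant"
  shows "u \<in> L"
  using assms by (cases u; cases v) (auto simp: lower_region_def octant_iff)

lemma region_boundary_iff: "v \<in> region_boundary L \<longleftrightarrow> v \<in> L \<and> v + (1, 1, 1) \<notin> L"
  by (cases v) (simp add: region_boundary_def)

lemma octant_alt: "v \<in> octant \<longleftrightarrow> fst v \<le> 0 \<and> fst (snd v) \<le> 0 \<and> snd (snd v) \<le> 0"
  by (cases v) (simp add: octant_iff)

lemma rhombus_between:
  "p \<in> rhombus q v \<Longrightarrow> p - v \<in> octant"
  "p \<in> rhombus q v \<Longrightarrow> (v + unit q) - (p + (1, 1, 1)) \<in> octant"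
  by (cases q; cases v; simp only: rhombus.simps; elim insertE emptyE; simp add: octant_alt)+

text \<open>A rhombus of type \<open>q\<close> at \<open>v\<close> spans a box with greatest point \<open>v\<close>, and adding \<open>(1, 1, 1)\<close> to its
least point gives \<open>v + unit q\<close>. Since the region is closed downwards, only these two extreme points
matter.\<close>

lemma tiles_region_boundary:
  assumes L: "lower_region L"
  shows "(q, v) \<in> tiles (region_boundary L) \<longleftrightarrow> v \<in> L \<and> v + unit q \<notin> L"
proof
  assume "(q, v) \<in> tiles (region_boundary L)"
  hence "v \<in> region_boundary L" "v - diag q \<in> region_boundary L"
    using top_in_rhombus [of v q] short_diag_subset_rhombus [of q v]
    unfolding tiles_def short_diag_alt by blast+
  moreover have "v - diag q + (1, 1, 1) = v + unit q"
    by (cases q; cases v) auto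
  ultimately show "v \<in> L \<and> v + unit q \<notin> L"
    by (simp add: region_boundary_iff)
next
  assume v: "v \<in> L \<and> v + unit q \<notin> L"
  have "p \<in> region_boundary L" if "p \<in> rhombus q v" for p
    unfolding region_boundary_iff
    using lower_region_down [OF L] rhombus_between [OF that] v by blast
  thus "(q, v) \<in> tiles (region_boundary L)" by (auto simp: tiles_def)
qed

lemma long_diag_alt: "long_diag q v = (\<lambda>r. v - unit r) ` (- {q})"
proof -
  have "- {q} = {r. r \<noteq> q}" by auto
  also have "\<dots> = (case q of Da \<Rightarrow> {Db, Dc} | Db \<Rightarrow> {Da, Dc} | Dc \<Rightarrow> {Da, Db})"
    by (cases q) (auto intro: dir.exhaust)
  finally show ?thesis by (cases q; cases v) auto
qed

lemma exchange_vertex: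
  assumes "a \<in> V" "b \<notin> V" "V' = insert b (V - {a})"
  shows "V = insert a (V' - {b})" "V' - {b} = V - {a}" "b \<in> V'" "a \<notin> V'"
  using assms by auto

lemma diag_unit: "unit q + diag q = (1, 1, 1)"
  by (cases q) auto

lemma long_diag_below: "long_diag q (v - unit q) = (\<lambda>r. v - diag r) ` (- {q})"
proof -
  have "v - unit q - unit r = v - diag t" if "q \<noteq> r" "t \<noteq> q" "t \<noteq> r" for r t
    using that by (cases v; cases q; cases r; cases t) auto
  note * = this
  show ?thesis unfolding long_diag_alt
  proof (intro equalityI image_subsetI)
    fix r assume "r \<in> - {q}"
    moreover obtain t where "t \<noteq> q" "t \<noteq> r" using third_dir by blast
    ultimately show "v - unit q - unit r \<in> (\<lambda>r. v - diag r) ` (- {q})"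
      using * [of r t] by auto
  next
    fix t assume "t \<in> - {q}"
    moreover obtain r where "r \<noteq> q" "r \<noteq> t" using third_dir by blast
    ultimately show "v - diag t \<in> (\<lambda>r. v - unit q - unit r) ` (- {q})"
      using * [of r t] by force
  qed
qed

lemma finite_dir_set: "finite (T :: dir set)"
  by (rule finite_subset [OF subset_UNIV]) (simp add: UNIV_dir)

text \<open>The configurations outside of a cube that can be completed to a grove by long diagonals in the
directions \<open>T\<close>.\<close>

definition pieces :: "point set \<Rightarrow> tile set \<Rightarrow> (dir \<Rightarrow> tile) \<Rightarrow> dir set \<Rightarrow> tile set set" where
  "pieces I K t T = {X. X \<subseteq> K \<and> X \<union> t ` T \<in> grove_tiles I}"

text \<open>The lower region loses a maximal point \<open>w\<close>. The initial conditions \<open>I\<^sub>u\<close> and \<open>I\<^sub>l\<close> differ by a cube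
with greatest vertex \<open>w\<close>, and \<open>K\<close> consists of the rhombi that they have in common.\<close>

locale elementary_move =
  fixes L :: "point set" and w :: point
  assumes lower: "lower_region L" and upper: "lower_region (insert w L)" and w: "w \<notin> L"
begin

abbreviation "I\<^sub>u \<equiv> region_boundary (insert w L)"
abbreviation "I\<^sub>l \<equiv> region_boundary L"

definition K :: "tile set" where "K = {(q, v). v \<in> L \<and> v + unit q \<notin> insert w L}"

definition upper_tile :: "dir \<Rightarrow> tile" where "upper_tile = (\<lambda>q. (q, w))"
definition lower_tile :: "dir \<Rightarrow> tile" where "lower_tile = (\<lambda>q. (q, w - unit q))"

lemma below_w: "u - w \<in> octant \<Longrightarrow> u \<noteq> w \<Longrightarrow> u \<in> L"
  using lower_region_down [OF upper, of w u] by simp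

lemma above_w: "w - u \<in> octant \<Longrightarrow> u \<noteq> w \<Longrightarrow> u \<notin> insert w L"
  using lower_region_down [OF lower, of u w] w by auto

lemma neighbours:
  "w - unit q \<in> L" "w - diag q \<in> L" "w + unit q \<notin> insert w L" "w + diag q \<notin> insert w L"
  "w - (1, 1, 1) \<in> L" "w + (1, 1, 1) \<notin> insert w L"
  by (intro below_w above_w; cases q; cases w; simp add: octant_alt)+

lemma tiles_upper: "tiles I\<^sub>u = K \<union> range upper_tile"
proof -
  have "(q, v) \<in> tiles I\<^sub>u \<longleftrightarrow> (q, v) \<in> K \<union> range upper_tile" for q v
    using neighbours(3) [of q] unfolding tiles_region_boundary [OF upper]
    by (auto simp: K_def upper_tile_def)
  thus ?thesis by (intro set_eqI) (metis surj_pair)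
qed

lemma tiles_lower: "tiles I\<^sub>l = K \<union> range lower_tile"
proof -
  have "(q, v) \<in> tiles I\<^sub>l \<longleftrightarrow> (q, v) \<in> K \<union> range lower_tile" for q v
    using neighbours(1) [of q] w unfolding tiles_region_boundary [OF lower]
    by (auto simp: K_def lower_tile_def)
  thus ?thesis by (intro set_eqI) (metis surj_pair)
qed

lemma K_disjoint: "K \<inter> range upper_tile = {}" "K \<inter> range lower_tile = {}"
  using w by (auto simp: K_def upper_tile_def lower_tile_def)

lemma inj_upper_tile: "inj upper_tile" and inj_lower_tile: "inj lower_tile"
  by (auto simp: inj_def upper_tile_def lower_tile_def)

lemma I_lower_eq: "I\<^sub>l = insert (w - (1, 1, 1)) (I\<^sub>u - {w})"
proof (intro set_eqI)
  fix v
  have "v + (1, 1, 1) = w \<longleftrightarrow> v = w - (1, 1, 1)" by (cases v; cases w) auto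
  thus "v \<in> I\<^sub>l \<longleftrightarrow> v \<in> insert (w - (1, 1, 1)) (I\<^sub>u - {w})"
    using neighbours(5,6) w by (auto simp: region_boundary_iff)
qed

lemma vertices: "w \<in> I\<^sub>u" "w - (1, 1, 1) \<notin> I\<^sub>u" "w - unit q \<in> I\<^sub>u - {w}" "w - diag q \<in> I\<^sub>u - {w}"
proof -
  have eqs: "w - unit q + (1, 1, 1) = w + diag q" "w - diag q + (1, 1, 1) = w + unit q"
    "w - (1, 1, 1) + (1, 1, 1) = w"
    by (cases w; cases q; simp)+
  have "w - unit q \<noteq> w" "w - diag q \<noteq> w" using neighbours(1,2) [of q] w by metis+
  thus "w - unit q \<in> I\<^sub>u - {w}" "w - diag q \<in> I\<^sub>u - {w}"
    unfolding region_boundary_iff Diff_iff eqs using neighbours(1-4) [of q] by blast+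
  show "w \<in> I\<^sub>u" using neighbours(6) by (simp add: region_boundary_iff)
  show "w - (1, 1, 1) \<notin> I\<^sub>u" unfolding region_boundary_iff eqs by simp
qed

definition outer_edges :: "tile set \<Rightarrow> point set set" where
  "outer_edges X = (\<lambda>(q, v). long_diag q v) ` X \<union> (\<lambda>(q, v). short_diag q v) ` (K - X)"

lemma outer_edges_vertices:
  assumes "X \<subseteq> K"
  shows "\<Union>(outer_edges X) \<subseteq> I\<^sub>u - {w}"
proof -
  have "rhombus q v \<subseteq> I\<^sub>u - {w}" if "(q, v) \<in> K" for q v
  proof -
    have "(q, v) \<in> tiles I\<^sub>u" "(q, v) \<in> tiles I\<^sub>l"
      using that unfolding tiles_upper tiles_lower by blast+
    moreover have "w \<notin> I\<^sub>l" using w by (auto simp: region_boundary_iff)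
    ultimately show ?thesis by (auto simp: tiles_def)
  qed
  hence "long_diag q v \<subseteq> I\<^sub>u - {w} \<and> short_diag q v \<subseteq> I\<^sub>u - {w}" if "(q, v) \<in> K" for q v
    using that long_diag_subset_rhombus [of q v] short_diag_subset_rhombus [of q v] by blast
  thus ?thesis using assms unfolding outer_edges_def by fast
qed

lemma upper_edges:
  assumes "X \<subseteq> K"
  shows "snd (tile_graph I\<^sub>u (X \<union> upper_tile ` T)) =
    outer_edges X \<union> star_triangle w (\<lambda>q. w - unit q) (\<lambda>q. w - diag q) T"
proof -
  have "tiles I\<^sub>u - (X \<union> upper_tile ` T) = (K - X) \<union> upper_tile ` (- T)"
    using assms K_disjoint(1) inj_upper_tile unfolding tiles_upper by (auto dest: injD)
  thus ?thesis
    by (simp add: tile_graph_def outer_edges_def star_triangle_def image_Un image_image upper_tile_def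
        long_diag_alt short_diag_alt Un_ac)
qed

lemma lower_edges:
  assumes "X \<subseteq> K"
  shows "snd (tile_graph I\<^sub>l (X \<union> lower_tile ` T)) =
    outer_edges X \<union> star_triangle (w - (1, 1, 1)) (\<lambda>q. w - diag q) (\<lambda>q. w - unit q) T"
proof -
  have "tiles I\<^sub>l - (X \<union> lower_tile ` T) = (K - X) \<union> lower_tile ` (- T)"
    using assms K_disjoint(2) inj_lower_tile unfolding tiles_lower by (auto dest: injD)
  moreover have "short_diag q (w - unit q) = {w - (1, 1, 1), w - unit q}" for q
    by (simp add: short_diag_alt diff_diff_eq diag_unit insert_commute)
  ultimately show ?thesis
    by (simp add: tile_graph_def outer_edges_def star_triangle_def image_Un image_image lower_tile_def
        long_diag_below Un_ac)
qed

lemma boundary_sets_avoid: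
  assumes "M \<ge> 3 - level w"
  shows "w \<notin> \<Union>(boundary_sets M)" "w - (1, 1, 1) \<notin> \<Union>(boundary_sets M)"
  using assms boundary_sets_level by fastforce+

lemma eventually_avoid:
  "\<forall>\<^sub>F M in at_top. w \<notin> \<Union>(boundary_sets M) \<and> w - (1, 1, 1) \<notin> \<Union>(boundary_sets M)"
  unfolding eventually_at_top_linorder using boundary_sets_avoid by blast

lemma not_eventually_linked:
  assumes "\<And>M. w \<notin> \<Union>(boundary_sets M) \<and> w - (1, 1, 1) \<notin> \<Union>(boundary_sets M) \<Longrightarrow> \<not> P M"
  shows "\<not> (\<forall>\<^sub>F M in at_top. P M)"
proof
  assume "\<forall>\<^sub>F M in at_top. P M"
  hence "\<forall>\<^sub>F M :: int in at_top. False"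
    using eventually_avoid by (rule eventually_elim2) (rule notE [OF assms])
  thus False by simp
qed

text \<open>The prescribed sets stay away from the cube for large \<open>M\<close>, so the exchange of a star and a
triangle applies to all of the conditions on the components that matter.\<close>

lemma grove_tiles_move:
  assumes X: "X \<subseteq> K" and T: "matched T T'"
  shows "X \<union> upper_tile ` T \<in> grove_tiles I\<^sub>u \<longleftrightarrow> X \<union> lower_tile ` T' \<in> grove_tiles I\<^sub>l"
proof -
  have "linked (boundary_sets M) I\<^sub>u (snd (tile_graph I\<^sub>u (X \<union> upper_tile ` T))) \<longleftrightarrow>
        linked (boundary_sets M) I\<^sub>l (snd (tile_graph I\<^sub>l (X \<union> lower_tile ` T')))"
    if M: "w \<notin> \<Union>(boundary_sets M) \<and> w - (1, 1, 1) \<notin> \<Union>(boundary_sets M)" for M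
    unfolding upper_edges [OF X] lower_edges [OF X]
  proof
    assume "linked (boundary_sets M) I\<^sub>u
      (outer_edges X \<union> star_triangle w (\<lambda>q. w - unit q) (\<lambda>q. w - diag q) T)"
    thus "linked (boundary_sets M) I\<^sub>l
      (outer_edges X \<union> star_triangle (w - (1, 1, 1)) (\<lambda>q. w - diag q) (\<lambda>q. w - unit q) T')"
      using vertices outer_edges_vertices [OF X] M
      by (intro linked_star_triangle [OF T _ _ I_lower_eq]) auto
  next
    note I\<^sub>u = exchange_vertex [OF vertices(1,2) I_lower_eq]
    assume "linked (boundary_sets M) I\<^sub>l
      (outer_edges X \<union> star_triangle (w - (1, 1, 1)) (\<lambda>q. w - diag q) (\<lambda>q. w - unit q) T')"
    thus "linked (boundary_sets M) I\<^sub>u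
      (outer_edges X \<union> star_triangle w (\<lambda>q. w - unit q) (\<lambda>q. w - diag q) T)"
      using vertices outer_edges_vertices [OF X] M
      by (intro linked_star_triangle [OF matched_sym [OF T] I\<^sub>u(3,4,1)]) (auto simp: I\<^sub>u(2))
  qed
  hence "(\<forall>\<^sub>F M in at_top. linked (boundary_sets M) I\<^sub>u (snd (tile_graph I\<^sub>u (X \<union> upper_tile ` T)))) \<longleftrightarrow>
         (\<forall>\<^sub>F M in at_top. linked (boundary_sets M) I\<^sub>l (snd (tile_graph I\<^sub>l (X \<union> lower_tile ` T'))))"
    by (intro eventually_cong eventually_mono [OF eventually_avoid])
  moreover have "X \<union> upper_tile ` T \<subseteq> tiles I\<^sub>u" "X \<union> lower_tile ` T' \<subseteq> tiles I\<^sub>l"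
    using X unfolding tiles_upper tiles_lower by auto
  ultimately show ?thesis
    by (simp add: grove_tiles_def finite_dir_set)
qed

lemma not_all_long:
  assumes X: "X \<subseteq> K"
  shows "X \<union> upper_tile ` UNIV \<notin> grove_tiles I\<^sub>u" "X \<union> lower_tile ` UNIV \<notin> grove_tiles I\<^sub>l"
proof -
  have "\<not> linked (boundary_sets M) I\<^sub>u (snd (tile_graph I\<^sub>u (X \<union> upper_tile ` UNIV)))"
    if M: "w \<notin> \<Union>(boundary_sets M)" for M
    unfolding upper_edges [OF X]
    using vertices outer_edges_vertices [OF X] M boundary_sets_nonempty
    by (intro linked_not_isolated [of w]) (auto simp: star_triangle_def)
  hence "\<not> (\<forall>\<^sub>F M in at_top. linked (boundary_sets M) I\<^sub>u (snd (tile_graph I\<^sub>u (X \<union> upper_tile ` UNIV))))"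
    by - (rule not_eventually_linked, drule conjunct1)
  thus "X \<union> upper_tile ` UNIV \<notin> grove_tiles I\<^sub>u" by (auto simp: grove_tiles_def)
  have "\<not> linked (boundary_sets M) I\<^sub>l (snd (tile_graph I\<^sub>l (X \<union> lower_tile ` UNIV)))"
    if M: "w - (1, 1, 1) \<notin> \<Union>(boundary_sets M)" for M
    unfolding lower_edges [OF X]
    using vertices outer_edges_vertices [OF X] M boundary_sets_nonempty
    by (intro linked_not_isolated [of "w - (1, 1, 1)"]) (auto simp: star_triangle_def I_lower_eq)
  hence "\<not> (\<forall>\<^sub>F M in at_top. linked (boundary_sets M) I\<^sub>l (snd (tile_graph I\<^sub>l (X \<union> lower_tile ` UNIV))))"
    by - (rule not_eventually_linked, drule conjunct2)
  thus "X \<union> lower_tile ` UNIV \<notin> grove_tiles I\<^sub>l" by (auto simp: grove_tiles_def)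
qed

lemma pieces_move: "matched T T' \<Longrightarrow> pieces I\<^sub>l K lower_tile T' = pieces I\<^sub>u K upper_tile T"
  using grove_tiles_move by (auto simp: pieces_def)

lemma pieces_UNIV: "pieces I\<^sub>u K upper_tile UNIV = {}" "pieces I\<^sub>l K lower_tile UNIV = {}"
  using not_all_long by (auto simp: pieces_def)

end

section \<open>Weights of groves under the elementary move\<close>

definition weight :: "conductance \<Rightarrow> tile set \<Rightarrow> real" where
  "weight C A = (\<Prod>(q, v)\<in>A. C q v)"

lemma weight_pos: "(\<And>q v. C q v > 0) \<Longrightarrow> weight C A > 0"
  unfolding weight_def by (intro prod_pos) auto

lemma grove_weight_tile_graph: "grove_weight C (tile_graph I A) = weight C A"
  by (simp add: grove_weight_def weight_def)

lemma finite_dir_set_set: "finite (S :: dir set set)"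
  by (rule finite_subset [OF subset_UNIV]) (simp add: Pow_UNIV [symmetric] UNIV_dir)

lemma sum_Pow_insert:
  assumes "finite F" "a \<notin> F"
  shows "(\<Sum>T\<in>Pow (insert a F). f T) = (\<Sum>T\<in>Pow F. f T + f (insert a T))"
proof -
  have "inj_on (insert a) (Pow F)" using assms(2) by (auto simp: inj_on_def)
  moreover have "Pow F \<inter> insert a ` Pow F = {}" using assms(2) by auto
  ultimately show ?thesis
    using assms(1) by (simp add: Pow_insert sum.union_disjoint sum.reindex sum.distrib)
qed

lemma sum_dir_sets:
  fixes f :: "dir set \<Rightarrow> real"
  shows "(\<Sum>T\<in>UNIV. f T) = f {} + f {Da} + f {Db} + f {Dc} + f {Db, Dc} + f {Da, Dc} + f {Da, Db} + f UNIV"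
proof -
  have "(\<Sum>T\<in>UNIV. f T) = (\<Sum>T\<in>Pow {Da, Db, Dc}. f T)" by (simp add: UNIV_dir [symmetric])
  thus ?thesis by (simp add: sum_Pow_insert UNIV_dir add_ac)
qed

text \<open>The weight of a grove is the product of its weights on the cube and outside of it.\<close>

lemma sum_grove_tiles:
  assumes tiles: "tiles I = K \<union> range t" and t: "inj t" and disj: "K \<inter> range t = {}"
    and fin: "finite (grove_tiles I)"
  shows "(\<Sum>A\<in>grove_tiles I. weight C A * h (A \<inter> K) * m (t -` A)) =
    (\<Sum>T\<in>UNIV. m T * (\<Prod>q\<in>T. case_prod C (t q)) * (\<Sum>X\<in>pieces I K t T. weight C X * h X))"
proof -
  have K: "(X \<union> t ` T) \<inter> K = X" and T: "t -` (X \<union> t ` T) = T" if "X \<subseteq> K" for X T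
  proof -
    have "t q \<notin> K" for q using disj by blast
    hence "t q \<notin> X" for q using that by blast
    thus "t -` (X \<union> t ` T) = T"
      by (intro set_eqI) (simp add: inj_image_mem_iff [OF t])
    show "(X \<union> t ` T) \<inter> K = X" using that \<open>\<And>q. t q \<notin> K\<close> by auto
  qed
  have reassemble: "(A \<inter> K) \<union> t ` (t -` A) = A" if "A \<in> grove_tiles I" for A
    using that tiles by (auto simp: grove_tiles_def)
  have finp: "finite (pieces I K t T)" for T
  proof (rule inj_on_finite [OF _ _ fin])
    show "inj_on (\<lambda>X. X \<union> t ` T) (pieces I K t T)"
      by (rule inj_on_inverseI [of _ "\<lambda>A. A \<inter> K"]) (auto simp: pieces_def K)
  qed (auto simp: pieces_def)
  have split: "weight C (X \<union> t ` T) = weight C X * (\<Prod>q\<in>T. case_prod C (t q))"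
    if "X \<in> pieces I K t T" for X T
  proof -
    have "finite X" "X \<inter> t ` T = {}" using that disj by (auto simp: pieces_def grove_tiles_def)
    thus ?thesis unfolding weight_def
      using t by (subst prod.union_disjoint)
        (auto simp: prod.reindex inj_on_def inj_def finite_dir_set)
  qed
  have "(\<Sum>A\<in>grove_tiles I. weight C A * h (A \<inter> K) * m (t -` A)) =
    (\<Sum>(T, X)\<in>Sigma UNIV (pieces I K t). weight C (X \<union> t ` T) * h X * m T)"
  proof (rule sum.reindex_bij_witness [of _ "\<lambda>(T, X). X \<union> t ` T" "\<lambda>A. (t -` A, A \<inter> K)"])
    fix A assume A: "A \<in> grove_tiles I"
    show "(case (t -` A, A \<inter> K) of (T, X) \<Rightarrow> X \<union> t ` T) = A"
      unfolding prod.case by (rule reassemble [OF A])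
    show "(t -` A, A \<inter> K) \<in> Sigma UNIV (pieces I K t)"
      unfolding pieces_def mem_Sigma_iff mem_Collect_eq reassemble [OF A] using A by simp
    show "(case (t -` A, A \<inter> K) of (T, X) \<Rightarrow> weight C (X \<union> t ` T) * h X * m T) =
        weight C A * h (A \<inter> K) * m (t -` A)"
      unfolding prod.case reassemble [OF A] ..
  next
    fix b assume "b \<in> Sigma UNIV (pieces I K t)"
    then obtain T X where b: "b = (T, X)" "X \<subseteq> K" "X \<union> t ` T \<in> grove_tiles I"
      by (auto simp: pieces_def)
    show "(t -` (case b of (T, X) \<Rightarrow> X \<union> t ` T), (case b of (T, X) \<Rightarrow> X \<union> t ` T) \<inter> K) = b"
      unfolding b(1) prod.case K [OF b(2)] T [OF b(2)] ..
    show "(case b of (T, X) \<Rightarrow> X \<union> t ` T) \<in> grove_tiles I"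
      unfolding b(1) prod.case by (rule b(3))
  qed
  also have "\<dots> = (\<Sum>T\<in>UNIV. \<Sum>X\<in>pieces I K t T. weight C (X \<union> t ` T) * h X * m T)"
    by (intro sum.Sigma [symmetric]) (auto simp: finite_dir_set_set finp)
  also have "\<dots> = (\<Sum>T\<in>UNIV. m T * (\<Prod>q\<in>T. case_prod C (t q)) * (\<Sum>X\<in>pieces I K t T. weight C X * h X))"
    by (intro sum.cong refl) (simp add: split sum_distrib_left mult_ac)
  finally show ?thesis .
qed

lemma matched_pairs:
  "matched {} {Db, Dc}" "matched {} {Da, Dc}" "matched {} {Da, Db}"
  "matched {Da} {Da}" "matched {Db} {Db}" "matched {Dc} {Dc}"
  "matched {Db, Dc} {}" "matched {Da, Dc} {}" "matched {Da, Db} {}"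
proof -
  have "- {Da} = {Db, Dc}" "- {Db} = {Da, Dc}" "- {Dc} = {Da, Db}"
    by (auto intro: dir.exhaust)
  thus "matched {} {Db, Dc}" "matched {} {Da, Dc}" "matched {} {Da, Db}"
    "matched {Da} {Da}" "matched {Db} {Db}" "matched {Dc} {Dc}"
    "matched {Db, Dc} {}" "matched {Da, Dc} {}" "matched {Da, Db} {}"
    unfolding matched_def by metis+
qed

lemma matched_exists: "T \<noteq> UNIV \<Longrightarrow> \<exists>T'. matched T T'"
proof -
  assume T: "T \<noteq> UNIV"
  have "T \<in> Pow {Da, Db, Dc}" by (simp add: UNIV_dir [symmetric])
  hence "T \<in> {{}, {Da}, {Db}, {Dc}, {Db, Dc}, {Da, Dc}, {Da, Db}}"
    using T by (auto simp: Pow_insert UNIV_dir)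
  thus ?thesis using matched_pairs by blast
qed

text \<open>The coefficients are defined by the conductances at the bottom of the cube, which are those on
its top divided by the sum of the pairwise products. This makes them the conditional probabilities
also on the top, given that it carries two long diagonals.\<close>

lemma coef_eq:
  assumes pos: "\<And>q v. C q v > 0" and "YD_consistent C"
  defines "s \<equiv> \<lambda>v. pair_sum (\<lambda>r. C r v)"
  shows "coef C Da v = C Db v * C Dc v / s v" "coef C Db v = C Da v * C Dc v / s v"
    "coef C Dc v = C Da v * C Db v / s v"
proof -
  obtain i j k where v: "v = (i, j, k)" by (cases v)
  have s: "s v > 0" unfolding s_def using pos by (rule pair_sum_pos)
  have b: "C Da (i - 1, j, k) = C Da v / s v" "C Db (i, j - 1, k) = C Db v / s v"
    "C Dc (i, j, k - 1) = C Dc v / s v"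
    using YD_consistent_downward [OF assms(1,2), of Da v] YD_consistent_downward [OF assms(1,2), of Db v]
      YD_consistent_downward [OF assms(1,2), of Dc v] by (simp_all add: v s_def)
  have D: "Delta_coef C (i, j, k) = 1 / s v"
  proof -
    have "Delta_coef C (i, j, k) = pair_sum (\<lambda>r. C r v / s v)"
      by (simp add: Delta_coef_def b pair_sum_def)
    also have "\<dots> = s v / s v ^ 2" unfolding pair_sum_divide by (simp add: s_def)
    finally show ?thesis using s by (simp add: power2_eq_square)
  qed
  show "coef C Da v = C Db v * C Dc v / s v" "coef C Db v = C Da v * C Dc v / s v"
    "coef C Dc v = C Da v * C Db v / s v"
    using s by (simp_all add: v U_coef_def V_coef_def W_coef_def D) (simp_all add: b v)
qed

text \<open>All long edge probabilities for the initial conditions of \<open>L\<close> are given by the recurrence. They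
are stated without division, as sums over groves.\<close>

definition determined :: "conductance \<Rightarrow> point set \<Rightarrow> bool" where
  "determined C L \<longleftrightarrow> (let \<G> = grove_tiles (region_boundary L) in finite \<G> \<and> \<G> \<noteq> {} \<and>
     (\<forall>q v. v \<in> L \<and> v + unit q \<notin> L \<longrightarrow>
       (\<Sum>A\<in>\<G>. weight C A * of_bool ((q, v) \<in> A)) = edge_density (coef C) q v * (\<Sum>A\<in>\<G>. weight C A)))"

context elementary_move
begin

lemma piece_of_grove:
  assumes "A \<in> grove_tiles I\<^sub>u"
  shows "A \<inter> K \<in> pieces I\<^sub>u K upper_tile (upper_tile -` A)" "upper_tile -` A \<noteq> UNIV"
proof -
  have "A = (A \<inter> K) \<union> upper_tile ` (upper_tile -` A)"
    using assms tiles_upper by (auto simp: grove_tiles_def)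
  thus *: "A \<inter> K \<in> pieces I\<^sub>u K upper_tile (upper_tile -` A)" using assms by (auto simp: pieces_def)
  show "upper_tile -` A \<noteq> UNIV" using * pieces_UNIV(1) by force
qed

lemma piece_of_grove_lower:
  assumes "A \<in> grove_tiles I\<^sub>l"
  shows "A = (A \<inter> K) \<union> lower_tile ` (lower_tile -` A)" "A \<inter> K \<in> pieces I\<^sub>l K lower_tile (lower_tile -` A)" "lower_tile -` A \<noteq> UNIV"
proof -
  show eq: "A = (A \<inter> K) \<union> lower_tile ` (lower_tile -` A)"
    using assms tiles_lower by (auto simp: grove_tiles_def)
  thus *: "A \<inter> K \<in> pieces I\<^sub>l K lower_tile (lower_tile -` A)" using assms by (auto simp: pieces_def)
  show "lower_tile -` A \<noteq> UNIV" using * pieces_UNIV(2) by force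
qed

lemma finite_grove_tiles_lower:
  assumes "finite (grove_tiles I\<^sub>u)"
  shows "finite (grove_tiles I\<^sub>l)"
proof (rule finite_subset)
  let ?S = "((\<lambda>A. A \<inter> K) ` grove_tiles I\<^sub>u) \<times> (UNIV :: dir set set)"
  show "grove_tiles I\<^sub>l \<subseteq> (\<lambda>(X, T). X \<union> lower_tile ` T) ` ?S"
  proof
    fix A assume A: "A \<in> grove_tiles I\<^sub>l"
    obtain T where "matched T (lower_tile -` A)"
      using matched_exists [OF piece_of_grove_lower(3) [OF A]] matched_sym by blast
    hence "A \<inter> K \<in> pieces I\<^sub>u K upper_tile T" using piece_of_grove_lower(2) [OF A] pieces_move by simp
    hence "(A \<inter> K) \<union> upper_tile ` T \<in> grove_tiles I\<^sub>u" by (simp add: pieces_def)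
    moreover have "((A \<inter> K) \<union> upper_tile ` T) \<inter> K = A \<inter> K" using K_disjoint(1) by auto
    ultimately have "A \<inter> K \<in> (\<lambda>A. A \<inter> K) ` grove_tiles I\<^sub>u" by (metis imageI)
    thus "A \<in> (\<lambda>(X, T). X \<union> lower_tile ` T) ` ?S"
      using piece_of_grove_lower(1) [OF A] by (intro image_eqI [of _ _ "(A \<inter> K, lower_tile -` A)"]) auto
  qed
  show "finite ((\<lambda>(X, T). X \<union> lower_tile ` T) ` ?S)"
    using assms finite_dir_set_set by simp
qed

lemma grove_tiles_lower_nonempty:
  assumes "grove_tiles I\<^sub>u \<noteq> {}"
  shows "grove_tiles I\<^sub>l \<noteq> {}"
proof -
  obtain A where A: "A \<in> grove_tiles I\<^sub>u" using assms by blast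
  obtain T' where "matched (upper_tile -` A) T'" using matched_exists [OF piece_of_grove(2) [OF A]] by blast
  hence "A \<inter> K \<in> pieces I\<^sub>l K lower_tile T'" using piece_of_grove(1) [OF A] pieces_move by simp
  thus ?thesis by (auto simp: pieces_def)
qed

text \<open>Sums over groves on both sides of the cube, expressed by the same three kinds of outer
configurations: those that go with no long diagonal on the top, with a single one, and with two. The
first and the last change places at the bottom. The function \<open>h\<close> weighs the outer part and \<open>m\<close>
the part on the cube.\<close>

lemma sums_over_groves:
  fixes C :: conductance and h :: "tile set \<Rightarrow> real" and m :: "dir set \<Rightarrow> real"
  assumes fin: "finite (grove_tiles I\<^sub>u)"
  defines "H \<equiv> \<lambda>T. \<Sum>X\<in>pieces I\<^sub>u K upper_tile T. weight C X * h X"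
  defines "c \<equiv> \<lambda>q. C q w" and "b \<equiv> \<lambda>q. C q (w - unit q)"
  shows
    "(\<Sum>A\<in>grove_tiles I\<^sub>u. weight C A * h (A \<inter> K) * m (upper_tile -` A)) =
       m {} * H {} + m {Da} * c Da * H {Da} + m {Db} * c Db * H {Db} + m {Dc} * c Dc * H {Dc} +
       (m {Db, Dc} * c Db * c Dc + m {Da, Dc} * c Da * c Dc + m {Da, Db} * c Da * c Db) * H {Da, Db}"
    (is ?upper)
    "(\<Sum>A\<in>grove_tiles I\<^sub>l. weight C A * h (A \<inter> K) * m (lower_tile -` A)) =
       m {} * H {Da, Db} + m {Da} * b Da * H {Da} + m {Db} * b Db * H {Db} + m {Dc} * b Dc * H {Dc} +
       (m {Db, Dc} * b Db * b Dc + m {Da, Dc} * b Da * b Dc + m {Da, Db} * b Da * b Db) * H {}"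
    (is ?lower)
proof -
  note mv = matched_pairs [THEN pieces_move]
  have "pieces I\<^sub>u K upper_tile {Db, Dc} = pieces I\<^sub>u K upper_tile {Da, Db}"
    "pieces I\<^sub>u K upper_tile {Da, Dc} = pieces I\<^sub>u K upper_tile {Da, Db}"
    using mv(7-9) by auto
  thus ?upper
    unfolding sum_grove_tiles [OF tiles_upper inj_upper_tile K_disjoint(1) fin] sum_dir_sets pieces_UNIV
    by (simp add: H_def c_def upper_tile_def algebra_simps)
  show ?lower
    unfolding sum_grove_tiles [OF tiles_lower inj_lower_tile K_disjoint(2) finite_grove_tiles_lower [OF fin]]
      sum_dir_sets pieces_UNIV mv(1-6,9)
    by (simp add: H_def b_def lower_tile_def algebra_simps)
qed

text \<open>The step of the induction. All sums over the upper groves are \<open>s\<close> times the corresponding sums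
over the lower ones when the summand depends on the outer part only; this settles the rhombi away from
the cube. For the three new rhombi, \<open>N {}\<close> and \<open>s * N {Da, Db}\<close> are the total weights on the top with
none and with two long diagonals, and by \<open>total\<close> their difference is the normalising constant times
\<open>1 - d Da - d Db - d Dc\<close>, which turns \<open>long_lower\<close> into the recurrence.\<close>

lemma determined_lower:
  assumes pos: "\<And>q v. C q v > 0" and YD: "YD_consistent C"
    and det: "determined C (insert w L)"
  shows "determined C L"
proof -
  have fin: "finite (grove_tiles I\<^sub>u)" and ne: "grove_tiles I\<^sub>u \<noteq> {}"
    and prob: "\<And>q v. v \<in> insert w L \<Longrightarrow> v + unit q \<notin> insert w L \<Longrightarrow>
       (\<Sum>A\<in>grove_tiles I\<^sub>u. weight C A * of_bool ((q, v) \<in> A)) =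
         edge_density (coef C) q v * (\<Sum>A\<in>grove_tiles I\<^sub>u. weight C A)"
    using det unfolding determined_def Let_def by blast+
  define c where "c = (\<lambda>q. C q w)"
  define s where "s = pair_sum c"
  have s: "s > 0" unfolding s_def c_def using pos by (rule pair_sum_pos)
  have b: "C q (w - unit q) = c q / s" for q
    using YD_consistent_downward [OF pos YD] by (simp add: s_def c_def)
  define Zu where "Zu = (\<Sum>A\<in>grove_tiles I\<^sub>u. weight C A)"
  define Zl where "Zl = (\<Sum>A\<in>grove_tiles I\<^sub>l. weight C A)"
  have c: "C q w = c q" for q by (simp add: c_def)
  note sums = sums_over_groves [OF fin, of C, unfolded b c]
  have b_sum: "c Db / s * (c Dc / s) + c Da / s * (c Dc / s) + c Da / s * (c Db / s) = 1 / s"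
  proof -
    have "c Db / s * (c Dc / s) + c Da / s * (c Dc / s) + c Da / s * (c Db / s) = s / s ^ 2"
      using pair_sum_divide [of c s] unfolding s_def [symmetric] by (simp add: pair_sum_def)
    thus ?thesis using s by (simp add: power2_eq_square)
  qed
  have scale: "(\<Sum>A\<in>grove_tiles I\<^sub>u. weight C A * h (A \<inter> K)) = s * (\<Sum>A\<in>grove_tiles I\<^sub>l. weight C A * h (A \<inter> K))" for h
    unfolding sums(1) [where h = h and m = "\<lambda>_. 1", unfolded mult_1_left mult_1_right]
      sums(2) [where h = h and m = "\<lambda>_. 1", unfolded mult_1_left mult_1_right] b_sum
    using s by (simp add: distrib_left) (simp add: s_def pair_sum_def algebra_simps)
  have Z: "Zu = s * Zl"
    using scale [of "\<lambda>_. 1"] by (simp add: Zu_def Zl_def)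
  define N where "N = (\<lambda>T. \<Sum>X\<in>pieces I\<^sub>u K upper_tile T. weight C X)"
  have coefs: "coef C Da w = c Db * c Dc / s" "coef C Db w = c Da * c Dc / s" "coef C Dc w = c Da * c Db / s"
    using coef_eq [OF pos YD, of w] by (simp_all add: c_def s_def)
  have s_eq: "s = c Da * c Db + c Da * c Dc + c Db * c Dc" by (simp add: s_def pair_sum_def)
  have long_upper: "(\<Sum>A\<in>grove_tiles I\<^sub>u. weight C A * of_bool ((q, w) \<in> A)) =
      c q * N {q} + s * (1 - coef C q w) * N {Da, Db}" for q
  proof -
    have "s * (1 - coef C Da w) = c Da * c Dc + c Da * c Db" "s * (1 - coef C Db w) = c Db * c Dc + c Da * c Db"
      "s * (1 - coef C Dc w) = c Db * c Dc + c Da * c Dc"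
      unfolding coefs right_diff_distrib using s by simp_all (simp_all add: s_eq)
    thus ?thesis
      using sums(1) [where h = "\<lambda>_. 1" and m = "\<lambda>T. of_bool (q \<in> T)"]
      by (cases q) (simp_all add: N_def upper_tile_def del: coef.simps)
  qed
  have long_lower: "s * (\<Sum>A\<in>grove_tiles I\<^sub>l. weight C A * of_bool ((q, w - unit q) \<in> A)) =
      c q * N {q} + (1 - coef C q w) * N {}" for q
  proof -
    have quot: "s * (x / s * (y / s) + z / s * (u / s)) = (x * y + z * u) / s" for x y z u
      using s by (simp add: field_simps)
    have compl: "1 - x / s = (s - x) / s" for x
      using s by (simp add: field_simps)
    have "1 - coef C Da w = s * (c Da / s * (c Dc / s) + c Da / s * (c Db / s))"
      "1 - coef C Db w = s * (c Db / s * (c Dc / s) + c Da / s * (c Db / s))"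
      "1 - coef C Dc w = s * (c Db / s * (c Dc / s) + c Da / s * (c Dc / s))"
      unfolding coefs quot compl by (simp_all add: s_eq)
    thus ?thesis
      using sums(2) [where h = "\<lambda>_. 1" and m = "\<lambda>T. of_bool (q \<in> T)"] s
      by (cases q) (simp_all add: N_def lower_tile_def distrib_left del: coef.simps)
  qed
  have total: "Zu = N {} + c Da * N {Da} + c Db * N {Db} + c Dc * N {Dc} + s * N {Da, Db}"
    using sums(1) [where h = "\<lambda>_. 1" and m = "\<lambda>_. 1"]
    by (simp add: Zu_def N_def s_def pair_sum_def algebra_simps)
  have "w \<in> octant" using upper by (simp add: lower_region_def)
  hence step: "edge_density (coef C) q (w - unit q) = edge_density (coef C) q w + (1 - coef C q w) *
     (1 - edge_density (coef C) Da w - edge_density (coef C) Db w - edge_density (coef C) Dc w)" for q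
    by (simp add: edge_density_step)
  have prob_lower: "(\<Sum>A\<in>grove_tiles I\<^sub>l. weight C A * of_bool ((q, v) \<in> A)) = edge_density (coef C) q v * Zl"
    if v: "v \<in> L" "v + unit q \<notin> L" for q v
  proof (cases "v + unit q = w")
    case False
    hence K: "(q, v) \<in> K" using v by (simp add: K_def)
    have "s * (\<Sum>A\<in>grove_tiles I\<^sub>l. weight C A * of_bool ((q, v) \<in> A)) = edge_density (coef C) q v * Zu"
      using scale [of "\<lambda>X. of_bool ((q, v) \<in> X)"] prob [of v q] v False K by (simp add: Zu_def)
    thus ?thesis using s by (simp add: Z)
  next
    case True
    hence v: "v = w - unit q" by (simp add: eq_diff_eq)
    define d where "d = (\<lambda>q. edge_density (coef C) q w)"
    have d: "edge_density (coef C) r w = d r" for r by (simp add: d_def)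
    have u: "d q * Zu = c q * N {q} + s * (1 - coef C q w) * N {Da, Db}" for q
      using prob [of w q] neighbours(3) [of q] long_upper [of q] by (simp add: d_def Zu_def)
    have "coef C Da w + coef C Db w + coef C Dc w = 1" using pos by (rule coef_sum)
    hence "(1 - d Da - d Db - d Dc) * Zu = N {} - s * N {Da, Db}"
      unfolding left_diff_distrib mult_1_left u unfolding total by algebra
    hence "edge_density (coef C) q v * Zu = c q * N {q} + (1 - coef C q w) * N {}"
      using u [of q] unfolding v step d by algebra
    also have "\<dots> = s * (\<Sum>A\<in>grove_tiles I\<^sub>l. weight C A * of_bool ((q, v) \<in> A))"
      unfolding v long_lower ..
    finally show ?thesis using s by (simp add: Z)
  qed
  show ?thesis
    unfolding determined_def Let_def
    using finite_grove_tiles_lower [OF fin] grove_tiles_lower_nonempty [OF ne] prob_lower [unfolded Zl_def]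
    by blast
qed

end

section \<open>Edge probabilities\<close>

lemma determined_octant: "determined C octant"
proof -
  have "edge_density (coef C) q v = 0" if "v + unit q \<notin> octant" for q v
    using that by (subst edge_density.simps) simp
  thus ?thesis by (simp add: determined_def grove_tiles_octant)
qed

text \<open>A point of the octant outside of \<open>L\<close> on the lowest possible level can be added to \<open>L\<close>, so that
\<open>L\<close> arises from a larger region by an elementary move.\<close>

lemma determined_region:
  assumes pos: "\<And>q v. C q v > 0" and YD: "YD_consistent C" and "lower_region L"
  shows "determined C L"
  using assms(3)
proof (induction "card (octant - L)" arbitrary: L)
  case 0
  hence "L = octant" by (auto simp: lower_region_def)
  thus ?case using determined_octant by simp
next
  case (Suc n)
  have fin: "finite (octant - L)" and sub: "L \<subseteq> octant" using Suc.prems by (auto simp: lower_region_def)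
  have "octant - L \<noteq> {}" using Suc.hyps(2) by force
  then obtain w where w: "w \<in> octant - L" "\<And>u. u \<in> octant - L \<Longrightarrow> level w \<le> level u"
    using fin by (metis arg_min_if_finite(1) arg_min_least)
  have "lower_region (insert w L)"
    unfolding lower_region_def
  proof (intro conjI allI impI)
    show "insert w L \<subseteq> octant" using w sub by blast
    show "finite (octant - insert w L)" using fin by (rule rev_finite_subset) blast
    fix i j k i' j' k' assume *: "(i, j, k) \<in> insert w L \<and> i' \<le> i \<and> j' \<le> j \<and> k' \<le> k"
    show "(i', j', k') \<in> insert w L"
    proof (cases "(i, j, k) \<in> L")
      case True
      thus ?thesis using Suc.prems * unfolding lower_region_def by blast
    next
      case False
      hence wijk: "w = (i, j, k)" using * by simp
      have "(i', j', k') \<in> octant" using w(1) * by (auto simp: wijk octant_iff)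
      moreover have "level (i', j', k') < level w" if "(i', j', k') \<noteq> w"
        using that * by (auto simp: wijk)
      ultimately show ?thesis using w(2) [of "(i', j', k')"] by (metis DiffI insertCI not_less)
    qed
  qed
  then interpret elementary_move L w
    using Suc.prems \<open>w \<in> octant - L\<close> by unfold_locales auto
  have "octant - insert w L = (octant - L) - {w}" by blast
  hence "card (octant - insert w L) = n"
    using Suc.hyps(2) card_Diff_singleton [OF \<open>w \<in> octant - L\<close>] by simp
  hence "determined C (insert w L)" using Suc.hyps(1) upper by blast
  thus ?case by (rule determined_lower [OF pos YD])
qed

lemma long_edge_probability:
  assumes pos: "\<And>q v. C q v > 0" and YD: "YD_consistent C"
    and I: "initial_conditions I" "rhombus q v \<subseteq> I"
  shows "measure (grove_measure C I) {G \<in> groves I. long_diag q v \<in> snd G} = edge_density (coef C) q v"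
proof -
  obtain L where L: "lower_region L" "I = region_boundary L"
    using I(1) by (auto simp: initial_conditions_def)
  have "(q, v) \<in> tiles I" using I(2) by (simp add: tiles_def)
  hence v: "v \<in> L" "v + unit q \<notin> L" unfolding L(2) tiles_region_boundary [OF L(1)] by auto
  have det: "determined C L" using pos YD L(1) by (rule determined_region)
  define \<G> where "\<G> = grove_tiles I"
  have fin: "finite \<G>" and ne: "\<G> \<noteq> {}" and prob: "(\<Sum>A\<in>\<G>. weight C A * of_bool ((q, v) \<in> A)) =
      edge_density (coef C) q v * (\<Sum>A\<in>\<G>. weight C A)"
    using det v unfolding determined_def Let_def \<G>_def L(2) by blast+
  define Z where "Z = (\<Sum>A\<in>\<G>. weight C A)"
  have Z: "Z > 0" unfolding Z_def using fin ne weight_pos [OF pos] by (intro sum_pos)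
  have "I \<subseteq> octant" using L by (auto simp: region_boundary_iff lower_region_def)
  hence groves: "groves I = tile_graph I ` \<G>" unfolding \<G>_def by (rule groves_eq)
  have inj: "inj_on (tile_graph I) S" for S using inj_tile_graph by (rule inj_on_subset) simp
  have norm: "(\<Sum>H\<in>groves I. grove_weight C H) = Z"
    unfolding groves Z_def by (simp add: sum.reindex [OF inj] grove_weight_tile_graph)
  have "measure (grove_measure C I) {G \<in> groves I. long_diag q v \<in> snd G} =
      (\<Sum>G | G \<in> groves I \<and> long_diag q v \<in> snd G. grove_weight C G / Z)"
  proof -
    have "grove_weight C G \<ge> 0" for G
      unfolding grove_weight_def using pos by (intro prod_nonneg) (auto intro: less_imp_le)
    thus ?thesis
      unfolding grove_measure_def norm using fin Z
      by (subst measure_point_measure_finite_if) (auto simp: groves)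
  qed
  also have set: "{G \<in> groves I. long_diag q v \<in> snd G} = tile_graph I ` {A \<in> \<G>. (q, v) \<in> A}"
    unfolding groves by auto
  also have "(\<Sum>G\<in>tile_graph I ` {A \<in> \<G>. (q, v) \<in> A}. grove_weight C G / Z) =
      (\<Sum>A\<in>\<G>. weight C A * of_bool ((q, v) \<in> A)) / Z"
    unfolding sum.reindex [OF inj] sum.inter_filter [OF fin] sum_divide_distrib o_def
      grove_weight_tile_graph
    by (intro sum.cong) auto
  also have "\<dots> = edge_density (coef C) q v"
    unfolding prob Z_def [symmetric] using Z by simp
  finally show ?thesis unfolding set .
qed

text \<open>By \<open>tiles_region_boundary\<close> it suffices to remove from the octant all points above
\<open>v + unit q\<close>.\<close>

lemma initial_conditions_through_rhombus:
  assumes "v \<in> octant"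
  shows "\<exists>I. initial_conditions I \<and> rhombus q v \<subseteq> I"
proof -
  define L where "L = {u \<in> octant. (v + unit q) - u \<notin> octant}"
  have "octant - L \<subseteq> {u \<in> octant. level u \<ge> level v + 1}"
  proof
    fix u assume "u \<in> octant - L"
    thus "u \<in> {u \<in> octant. level u \<ge> level v + 1}"
      using octant_level [of "v + unit q - u"] by (auto simp: L_def)
  qed
  hence "finite (octant - L)" using finite_octant_above by (rule finite_subset)
  hence L: "lower_region L"
    by (cases v; cases q) (auto simp: lower_region_def L_def octant_iff)
  have "v \<in> L" "v + unit q \<notin> L"
    using assms by (auto simp: L_def octant_alt) (cases q; auto)
  hence "(q, v) \<in> tiles (region_boundary L)" using tiles_region_boundary [OF L] by blast
  thus ?thesis using L unfolding initial_conditions_def tiles_def by blast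
qed

lemma edge_prob_eq_edge_density:
  assumes "\<And>q v. C q v > 0" "YD_consistent C" "v \<in> octant"
  shows "edge_prob C q v = edge_density (coef C) q v"
  unfolding edge_prob_def
  using initial_conditions_through_rhombus [OF assms(3), of q] long_edge_probability [OF assms(1,2)]
  by (intro the_equality) auto

section \<open>The linear systems\<close>

lemma on_class_eq:
  assumes "c \<in> period_classes N m n" "\<mu> \<in> c"
    and "\<And>\<mu> \<nu>. (\<mu>, \<nu>) \<in> period_rel N m n \<Longrightarrow> f \<mu> = f \<nu>"
  shows "on_class f c = f \<mu>"
proof -
  obtain x where x: "c = period_rel N m n `` {x}"
    using assms(1) unfolding period_classes_def by (rule quotientE)
  hence "(x, \<mu>) \<in> period_rel N m n" using assms(2) by simp
  hence c: "c = period_rel N m n `` {\<mu>}"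
    unfolding x by (rule equiv_class_eq [OF equiv_period_rel])
  have "f \<nu> = f \<mu>" if "\<nu> \<in> c" for \<nu>
    using that assms(3) [of \<mu> \<nu>] unfolding c by simp
  hence "f ` c = {f \<mu>}" using assms(2) by blast
  thus ?thesis by (simp add: on_class_def)
qed

context
  fixes C :: conductance and m n N :: nat
  assumes pos: "\<And>q v. C q v > 0" and YD: "YD_consistent C"
    and periodic: "\<forall>q v. \<forall>(\<mu>, \<nu>) \<in> period_rel N m n. coef C q (v + \<mu>) = coef C q (v + \<nu>)"
begin

lemma coef_period: "(\<mu>, \<nu>) \<in> period_rel N m n \<Longrightarrow> coef C q (v + \<mu>) = coef C q (v + \<nu>)"
  using periodic by blast

text \<open>The series of a class depend on the coefficients only, and are therefore periodic.\<close>

lemma edge_series_eq: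
  "edge_series C q \<mu> = gen_series (edge_density (\<lambda>r x. coef C r (x + \<mu>)) q)"
proof -
  have "edge_prob (shift C \<mu>) q v = edge_density (\<lambda>r x. coef C r (x + \<mu>)) q v" if "v \<in> octant" for v
    using edge_prob_eq_edge_density [of "shift C \<mu>" v q] pos YD_consistent_shift [OF pos YD] that
    by (simp add: coef_shift [abs_def]) (simp add: shift_def)
  thus ?thesis unfolding edge_series_def by (intro gen_series_cong)
qed

lemma classes_eq:
  assumes "c \<in> period_classes N m n" "\<mu> \<in> c"
  shows "U_class C c = coef C Da \<mu>" "V_class C c = coef C Db \<mu>" "W_class C c = coef C Dc \<mu>"
    "G_class C q c = edge_series C q \<mu>"
proof -
  have *: "coef (shift C \<mu>) r (0, 0, 0) = coef C r \<mu>" for r \<mu>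
    unfolding coef_shift by (simp flip: zero_prod_def)
  have per: "coef (shift C \<mu>) r (0, 0, 0) = coef (shift C \<nu>) r (0, 0, 0)"
    if "(\<mu>, \<nu>) \<in> period_rel N m n" for r \<mu> \<nu>
    using coef_period [OF that, of r 0] unfolding * by simp
  show "U_class C c = coef C Da \<mu>" "V_class C c = coef C Db \<mu>" "W_class C c = coef C Dc \<mu>"
    unfolding U_class_def V_class_def W_class_def
    using on_class_eq [OF assms per [where r = Da]] on_class_eq [OF assms per [where r = Db]]
      on_class_eq [OF assms per [where r = Dc]] * [of \<mu> Da] * [of \<mu> Db] * [of \<mu> Dc]
    by simp_all
  show "G_class C q c = edge_series C q \<mu>"
    unfolding G_class_def
    by (rule on_class_eq [OF assms]) (simp add: edge_series_eq coef_period)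
qed

text \<open>The monomial of \<open>e\<close> moves the apex of the octant for the class of \<open>\<mu> + e\<close> back to the position
of \<open>e\<close> relative to \<open>\<mu>\<close>, so that a row of the matrix becomes the combination of
\<open>cube_combination_density\<close>.\<close>

lemma linear_system:
  assumes "m \<ge> 1" "n \<ge> 1" "N \<ge> 1" and c: "c \<in> period_classes N m n" "\<mu> \<in> c"
  shows "mat_apply (period_classes N m n) (A_matrix C) (G_class C q) c =
    var q / (1 - var q) * const3 (1 - coef C q \<mu>)"
proof -
  define u where "u = (\<lambda>r x. coef C r (x + \<mu>))"
  define D where "D = (\<lambda>e v. edge_density (\<lambda>r x. u r (x + e)) q (v - e))"
  have u0: "u r (0, 0, 0) = coef C r \<mu>" for r by (simp add: u_def flip: zero_prod_def)
  have G: "G_class C q (class_shift c e) = gen_series (\<lambda>v. D e (v + e))" for e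
  proof -
    have "\<mu> + e \<in> class_shift c e" using c(2) by (auto simp: class_shift_def)
    hence "G_class C q (class_shift c e) = edge_series C q (\<mu> + e)"
      by (intro classes_eq(4) class_shift_in_classes c(1))
    thus ?thesis by (simp add: edge_series_eq D_def u_def add_ac)
  qed
  have G0: "G_class C q c = gen_series (D (0, 0, 0))"
    using G [of "(0, 0, 0)"] by (simp add: class_shift_def flip: zero_prod_def)
  have mult: "var r * gen_series (\<lambda>v. D e (v + d)) = gen_series (\<lambda>v. D e (v + (unit r + d)))"
    if "e - d \<in> octant" for r e d
  proof -
    have "D e (v + d) = 0" if "v \<notin> octant" for v
    proof -
      have "v + d - e \<notin> octant"
        using that \<open>e - d \<in> octant\<close> by (cases v; cases d; cases e) (auto simp: octant_iff)
      thus ?thesis unfolding D_def by (rule edge_density_outside)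
    qed
    hence "var r * gen_series (\<lambda>v. D e (v + d)) = gen_series (\<lambda>v. D e (v + unit r + d))"
      by (rule var_mult_gen_series)
    thus ?thesis by (simp add: add.assoc)
  qed
  have X: "X_var = var Da" and Y: "Y_var = var Db" and Z: "Z_var = var Dc" by simp_all
  have shifted:
    "X_var * G_class C q (class_shift c (-1, 0, 0)) = gen_series (D (-1, 0, 0))"
    "Y_var * G_class C q (class_shift c (0, -1, 0)) = gen_series (D (0, -1, 0))"
    "Z_var * G_class C q (class_shift c (0, 0, -1)) = gen_series (D (0, 0, -1))"
    "Y_var * Z_var * G_class C q (class_shift c (0, -1, -1)) = gen_series (D (0, -1, -1))"
    "X_var * Z_var * G_class C q (class_shift c (-1, 0, -1)) = gen_series (D (-1, 0, -1))"
    "X_var * Y_var * G_class C q (class_shift c (-1, -1, 0)) = gen_series (D (-1, -1, 0))"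
    "X_var * Y_var * Z_var * G_class C q (class_shift c (-1, -1, -1)) = gen_series (D (-1, -1, -1))"
    unfolding G X Y Z mult.assoc
    by (simp_all add: mult octant_alt del: var.simps) (simp_all flip: zero_prod_def)
  have sum: "u Da (0, 0, 0) + u Db (0, 0, 0) + u Dc (0, 0, 0) = 1"
    unfolding u0 using pos by (rule coef_sum)
  have "mat_apply (period_classes N m n) (A_matrix C) (G_class C q) c =
      gen_series (\<lambda>v. cube_combination (\<lambda>r. u r (0, 0, 0)) (\<lambda>e. D e v))"
    unfolding A_matrix_apply [OF assms(3,1,2) c(1)] classes_eq(1-3) [OF c] shifted G0
      gen_series_add gen_series_diff const3_mult_gen_series
    by (simp add: cube_combination_def u0 del: coef.simps)
  also have "\<dots> = gen_series (\<lambda>v. (1 - coef C q \<mu>) * of_bool (on_axis q v))"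
    unfolding D_def unfolding cube_combination_density [of u, OF sum] unfolding u0 by (simp only: mult.commute)
  also have "\<dots> = var q / (1 - var q) * const3 (1 - coef C q \<mu>)"
    unfolding var_geometric const3_mult_gen_series [symmetric] by (rule mult.commute)
  finally show ?thesis .
qed

end

theorem theorem4p1:
  fixes m n N :: nat and Ct C :: conductance
  assumes "m \<ge> 1" and "n \<ge> 1" and "N \<ge> 1"
    and "torus_conductance m n Ct" and "torus_positive Ct" and "T_periodic N Ct"
    and "C = YD_extension Ct"
  shows "(\<forall>c \<in> period_classes N m n.
           mat_apply (period_classes N m n) (A_matrix C) (G_class C Da) c
             = X_var / (1 - X_var) * const3 (V_class C c + W_class C c)) \<and>
         (\<forall>c \<in> period_classes N m n.
           mat_apply (period_classes N m n) (A_matrix C) (G_class C Db) c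
             = Y_var / (1 - Y_var) * const3 (U_class C c + W_class C c)) \<and>
         (\<forall>c \<in> period_classes N m n.
           mat_apply (period_classes N m n) (A_matrix C) (G_class C Dc) c
             = Z_var / (1 - Z_var) * const3 (U_class C c + V_class C c))"
  proof -
  note C = YD_extension_properties [OF assms(5), folded assms(7)]
  have periodic: "\<forall>q v. \<forall>(\<mu>, \<nu>) \<in> period_rel N m n. coef C q (v + \<mu>) = coef C q (v + \<nu>)"
    unfolding assms(7) using coef_periodic [OF assms(5,4,6)] by blast
  have system: "mat_apply (period_classes N m n) (A_matrix C) (G_class C q) c =
      var q / (1 - var q) * const3 (1 - (case q of Da \<Rightarrow> U_class C c | Db \<Rightarrow> V_class C c | Dc \<Rightarrow> W_class C c))
    \<and> U_class C c + V_class C c + W_class C c = 1"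
    if c: "c \<in> period_classes N m n" for c q
  proof -
    obtain \<mu> where \<mu>: "c = period_rel N m n `` {\<mu>}"
      using c unfolding period_classes_def by (rule quotientE)
    hence \<mu>c: "\<mu> \<in> c" using equiv_class_self [OF equiv_period_rel] by simp
    note cls = classes_eq(1-3) [OF C(1,2) periodic c \<mu>c]
    show ?thesis
      using linear_system [OF C(1,2) periodic assms(1-3) c \<mu>c] coef_sum [of C \<mu>, OF C(1)]
      unfolding cls by (cases q) simp_all
  qed
  have "1 - U_class C c = V_class C c + W_class C c" "1 - V_class C c = U_class C c + W_class C c"
    "1 - W_class C c = U_class C c + V_class C c" if "c \<in> period_classes N m n" for c
    using system [OF that, of Da] by linarith+
  thus ?thesis
    using system [of _ Da] system [of _ Db] system [of _ Dc] by simp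
qed

end
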